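(* There is a computable linear order $\mathcal{L}$ of order-type $\omega$ such that $\mathcal{L}$ is not computably isomorphic to the standard presentation $(\mathbb{N},<)$ of $\omega$, yet for every cohesive set $C\subseteq\mathbb{N}$ the cohesive power $\Pi_C\mathcal{L}$ has order-type $\omega+\zeta\eta$.
   Context: A set $C\subseteq\mathbb{N}$ is cohesive if it is infinite and for every c.e. set $W$, either $C\setminus W$ or $C\cap W$ is finite. Write $X\subseteq^* Y$ if $X\setminus Y$ is finite. For a computable linear order $\mathcal{L}=(L,\prec_{\mathcal{L}})$ (computable domain $L\subseteq\mathbb{N}$, computable order), the cohesive power $\Pi_C\mathcal{L}$ has as elements the classes $[\varphi]$ of partial computable $\varphi\colon\mathbb{N}\to L$ with $C\subseteq^*\mathrm{dom}(\varphi)$ under $\varphi=_C\psi$ iff $C\subseteq^*\{x:\varphi(x)\downarrow=\psi(x)\downarrow\}$, ordered by $[\varphi]\prec[\psi]$ iff $C\subseteq^*\{x:\varphi(x)\downarrow,\psi(x)\downarrow,\varphi(x)\prec_{\mathcal{L}}\psi(x)\}$. $\omega,\zeta,\eta$ are the order-types of $\mathbb{N},\mathbb{Z},\mathbb{Q}$; $\zeta\eta$ means $\eta$-many copies of $\zeta$ ordered lexicographically. *)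

theory Defs
  imports Complex_Main
begin

section \<open>Partial computable functions\<close>

text \<open>
  The Isabelle distribution has no computability theory, so Kleene's partial recursive functions
  are introduced here: programs, and their denotations as partial functions on argument lists.
  Programs carry no arity. A projection whose index is out of range is undefined, as are the
  successor on an argument list that is not a singleton and primitive recursion on the empty list.
\<close>

datatype recf =
    Zero
  | Succ
  | Proj nat
  | Comp recf "recf list"
  | PrimRec recf recf
  | Mu recf

primrec eval :: "recf \<Rightarrow> nat list \<Rightarrow> nat option" where
  "eval Zero = (\<lambda>xs. Some 0)"
| "eval Succ = (\<lambda>xs. case xs of [x] \<Rightarrow> Some (Suc x) | _ \<Rightarrow> None)"
| "eval (Proj i) = (\<lambda>xs. if i < length xs then Some (xs ! i) else None)"
| "eval (Comp f gs) = (\<lambda>xs. Option.bind (those (map (\<lambda>g. eval g xs) gs)) (eval f))"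
| "eval (PrimRec f g) = (\<lambda>xs. case xs of
      [] \<Rightarrow> None
    | n # ys \<Rightarrow>
        rec_nat (eval f ys) (\<lambda>k r. Option.bind r (\<lambda>v. eval g (k # v # ys))) n)"
| "eval (Mu f) = (\<lambda>xs.
      if \<exists>z. eval f (z # xs) = Some 0 \<and> (\<forall>y<z. eval f (y # xs) \<noteq> None)
      then Some (LEAST z. eval f (z # xs) = Some 0)
      else None)"

definition partial_computable :: "(nat \<Rightarrow> nat option) \<Rightarrow> bool" where
  "partial_computable \<phi> \<longleftrightarrow> (\<exists>f. \<forall>x. \<phi> x = eval f [x])"

definition computable_set :: "nat set \<Rightarrow> bool" where
  "computable_set A \<longleftrightarrow> (\<exists>f. \<forall>x. eval f [x] = Some (of_bool (x \<in> A)))"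

definition computable_rel :: "nat rel \<Rightarrow> bool" where
  "computable_rel r \<longleftrightarrow> (\<exists>f. \<forall>x y. eval f [x, y] = Some (of_bool ((x, y) \<in> r)))"

definition ce_set :: "nat set \<Rightarrow> bool" where
  "ce_set W \<longleftrightarrow> (\<exists>\<phi>. partial_computable \<phi> \<and> W = dom \<phi>)"


section \<open>Linear orders and order-types\<close>

text \<open>
  A linear order is a carrier set together with its strict order relation. The inclusion in
  \<open>computable_linear_order\<close> is needed because \<^const>\<open>strict_linear_order_on\<close> does not confine the
  relation to the carrier.
\<close>

definition computable_linear_order :: "nat set \<Rightarrow> nat rel \<Rightarrow> bool" where
  "computable_linear_order L r \<longleftrightarrow>
     r \<subseteq> L \<times> L \<and> strict_linear_order_on L r \<and> computable_set L \<and> computable_rel r"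

definition order_iso :: "('a \<Rightarrow> 'b) \<Rightarrow> 'a set \<Rightarrow> 'a rel \<Rightarrow> 'b set \<Rightarrow> 'b rel \<Rightarrow> bool" where
  "order_iso f A r B s \<longleftrightarrow>
     bij_betw f A B \<and> (\<forall>x\<in>A. \<forall>y\<in>A. (x, y) \<in> r \<longleftrightarrow> (f x, f y) \<in> s)"

text \<open>\<open>(A, r)\<close> has the order-type of \<open>(B, s)\<close>.\<close>

definition same_order_type :: "'a set \<Rightarrow> 'a rel \<Rightarrow> 'b set \<Rightarrow> 'b rel \<Rightarrow> bool" where
  "same_order_type A r B s \<longleftrightarrow> (\<exists>f. order_iso f A r B s)"

definition computably_isomorphic :: "nat set \<Rightarrow> nat rel \<Rightarrow> nat set \<Rightarrow> nat rel \<Rightarrow> bool" where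
  "computably_isomorphic A r B s \<longleftrightarrow>
     (\<exists>\<phi>. partial_computable \<phi> \<and> dom \<phi> = A \<and> order_iso (\<lambda>x. the (\<phi> x)) A r B s)"

definition less_rel :: "'a::linorder rel" where
  "less_rel = {(x, y). x < y}"

definition order_sum :: "'a rel \<Rightarrow> 'b rel \<Rightarrow> ('a + 'b) rel" where
  "order_sum r s =
     {(Inl x, Inl y) | x y. (x, y) \<in> r} \<union> {(Inl x, Inr y) | x y. True} \<union>
     {(Inr x, Inr y) | x y. (x, y) \<in> s}"

text \<open>
  The product \<open>\<zeta>\<eta>\<close> replaces each point of \<open>\<eta>\<close> by a copy of \<open>\<zeta>\<close>, so the rational coordinate is
  the dominant one.
\<close>

definition omega_plus_zeta_eta :: "(nat + rat \<times> int) rel" where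
  "omega_plus_zeta_eta =
     order_sum (less_rel :: nat rel) ((less_rel :: rat rel) <*lex*> (less_rel :: int rel))"


section \<open>Cohesive powers\<close>

definition almost_subset :: "'a set \<Rightarrow> 'a set \<Rightarrow> bool" (infix \<open>\<subseteq>*\<close> 50) where
  "X \<subseteq>* Y \<longleftrightarrow> finite (X - Y)"

definition cohesive :: "nat set \<Rightarrow> bool" where
  "cohesive C \<longleftrightarrow> infinite C \<and> (\<forall>W. ce_set W \<longrightarrow> finite (C - W) \<or> finite (C \<inter> W))"

definition cohesive_funs :: "nat set \<Rightarrow> nat set \<Rightarrow> (nat \<Rightarrow> nat option) set" where
  "cohesive_funs C L = {\<phi>. partial_computable \<phi> \<and> ran \<phi> \<subseteq> L \<and> C \<subseteq>* dom \<phi>}"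

definition cohesive_eq :: "nat set \<Rightarrow> nat set \<Rightarrow> (nat \<Rightarrow> nat option) rel" where
  "cohesive_eq C L =
     {(\<phi>, \<psi>). \<phi> \<in> cohesive_funs C L \<and> \<psi> \<in> cohesive_funs C L \<and>
        C \<subseteq>* {x. \<exists>a. \<phi> x = Some a \<and> \<psi> x = Some a}}"

definition cohesive_power :: "nat set \<Rightarrow> nat set \<Rightarrow> (nat \<Rightarrow> nat option) set set" where
  "cohesive_power C L = cohesive_funs C L // cohesive_eq C L"

definition cohesive_fun_less ::
    "nat set \<Rightarrow> nat rel \<Rightarrow> (nat \<Rightarrow> nat option) \<Rightarrow> (nat \<Rightarrow> nat option) \<Rightarrow> bool" where
  "cohesive_fun_less C r \<phi> \<psi> \<longleftrightarrow>
     C \<subseteq>* {x. \<exists>a b. \<phi> x = Some a \<and> \<psi> x = Some b \<and> (a, b) \<in> r}"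

definition cohesive_power_less ::
    "nat set \<Rightarrow> nat set \<Rightarrow> nat rel \<Rightarrow> (nat \<Rightarrow> nat option) set rel" where
  "cohesive_power_less C L r =
     {(P, Q). P \<in> cohesive_power C L \<and> Q \<in> cohesive_power C L \<and>
        (\<exists>\<phi>\<in>P. \<exists>\<psi>\<in>Q. cohesive_fun_less C r \<phi> \<psi>)}"

text \<open>
  The following two facts show that the quotient is one by an equivalence relation, and that the
  choice of representatives in \<^const>\<open>cohesive_power_less\<close> is immaterial.
\<close>

lemma almost_subset_Int2:
  assumes "C \<subseteq>* X" "C \<subseteq>* Y" "X \<inter> Y \<subseteq> Z"
  shows "C \<subseteq>* Z"
proof -
  have "C - Z \<subseteq> (C - X) \<union> (C - Y)" using assms(3) by blast
  then show ?thesis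
    using assms(1,2) unfolding almost_subset_def by (meson finite_UnI finite_subset)
qed

lemma equiv_cohesive_eq: "equiv (cohesive_funs C L) (cohesive_eq C L)"
proof (rule equivI)
  show "cohesive_eq C L \<subseteq> cohesive_funs C L \<times> cohesive_funs C L"
    by (auto simp: cohesive_eq_def)
  show "refl_on (cohesive_funs C L) (cohesive_eq C L)"
    by (auto simp: refl_on_def cohesive_eq_def cohesive_funs_def dom_def)
  show "sym (cohesive_eq C L)"
  proof (rule symI)
    fix \<phi> \<psi> assume *: "(\<phi>, \<psi>) \<in> cohesive_eq C L"
    have "{x. \<exists>a. \<phi> x = Some a \<and> \<psi> x = Some a} = {x. \<exists>a. \<psi> x = Some a \<and> \<phi> x = Some a}"
      by auto
    with * show "(\<psi>, \<phi>) \<in> cohesive_eq C L"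
      by (simp add: cohesive_eq_def)
  qed
  show "trans (cohesive_eq C L)"
  proof (rule transI)
    fix \<phi> \<psi> \<theta> assume 1: "(\<phi>, \<psi>) \<in> cohesive_eq C L" and 2: "(\<psi>, \<theta>) \<in> cohesive_eq C L"
    have "C \<subseteq>* {x. \<exists>a. \<phi> x = Some a \<and> \<psi> x = Some a}"
      using 1 unfolding cohesive_eq_def by blast
    moreover have "C \<subseteq>* {x. \<exists>a. \<psi> x = Some a \<and> \<theta> x = Some a}"
      using 2 unfolding cohesive_eq_def by blast
    ultimately have "C \<subseteq>* {x. \<exists>a. \<phi> x = Some a \<and> \<theta> x = Some a}"
      by (rule almost_subset_Int2) auto
    with 1 2 show "(\<phi>, \<theta>) \<in> cohesive_eq C L"
      unfolding cohesive_eq_def by blast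
  qed
qed

lemma cohesive_fun_less_cong:
  assumes "(\<phi>, \<phi>') \<in> cohesive_eq C L" "(\<psi>, \<psi>') \<in> cohesive_eq C L" "cohesive_fun_less C r \<phi> \<psi>"
  shows "cohesive_fun_less C r \<phi>' \<psi>'"
proof -
  let ?E = "\<lambda>\<phi> \<phi>'. {x. \<exists>a. \<phi> x = Some a \<and> \<phi>' x = (Some a :: nat option)}"
  have "C \<subseteq>* ?E \<phi> \<phi>'" "C \<subseteq>* ?E \<psi> \<psi>'"
    using assms(1,2) by (auto simp: cohesive_eq_def)
  then have "C \<subseteq>* ?E \<phi> \<phi>' \<inter> ?E \<psi> \<psi>'"
    by (rule almost_subset_Int2) simp
  then show ?thesis
    using assms(3) unfolding cohesive_fun_less_def
    by (rule almost_subset_Int2) auto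
qed

end

(*
  Let K be a noncomputable c.e. set. The order L has, for each a, an element of rank 2a and, at the
  stage at which a enters K, a further element of rank 2a + 1. Its ranks form a c.e. set S of natural
  numbers, so L has order-type omega. A computable isomorphism with (N, <) would decide K, since it
  tells whether the elements of ranks 2a and 2a + 2 are adjacent.

  In a cohesive power, a c.e. property of a partial computable function holds either almost
  everywhere or almost nowhere on C. In particular this applies to "rank + 1 belongs to S", so each
  element has an immediate successor, of rank larger by 1 or by 2, and likewise a predecessor unless
  it is the least one. Since S contains all even numbers, there is an element midway between any two
  elements that are infinitely far apart and one far above any given element. A countable order with
  these properties is omega + zeta eta by Cantor's theorem, applied to representatives of the blocks
  of elements at finite distance other than the first block.
*)

theory Submission
  imports
    Defs
    "HOL-Library.Countable"
    "HOL-Library.Countable_Set"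
    "HOL-Library.Infinite_Set"
    "HOL-Library.Nat_Bijection"
begin

section \<open>Total computable functions\<close>

text \<open>The successor map of the order itself cannot be computable, since it would decide which
  odd ranks occur. In a power this is harmless: cohesiveness settles once for each class whether the
  next rank is one or two higher, and then one of the two computable maps \<open>n + 1\<close>,
  \<open>n + 2\<close> yields the successor almost everywhere on the cohesive set. No uniform choice
  between them is required. Doubling the ranks serves both sides: odd numbers hide the noncomputable
  set, while any arithmetical construction can be rounded to an even number and so lands in the
  order.

  The c.e. set must come with a decidable stage relation. Instead of a universal program,
  evaluations are certified by finite sets of judgements coded in binary, so that checking a
  certificate is bounded quantification over bits. The set consists of the programs that return 0 on
  their own code, and the least certificate plays the part of the stage.

  In the power, classes are handled through natural-number-valued rank functions and "almost
  everywhere on \<open>C\<close>" through a filter. Order, equality and infinite distance then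
  become pointwise arithmetic.\<close>

definition computable_on_lists :: "nat \<Rightarrow> (nat list \<Rightarrow> nat) \<Rightarrow> bool" where
  "computable_on_lists k F \<longleftrightarrow> (\<exists>p. \<forall>xs. length xs = k \<longrightarrow> eval p xs = Some (F xs))"

definition computable_fun :: "(nat \<Rightarrow> nat) \<Rightarrow> bool" where
  "computable_fun f \<longleftrightarrow> computable_on_lists 1 (\<lambda>xs. f (xs ! 0))"

definition computable_fun2 :: "(nat \<Rightarrow> nat \<Rightarrow> nat) \<Rightarrow> bool" where
  "computable_fun2 g \<longleftrightarrow> computable_on_lists 2 (\<lambda>xs. g (xs ! 0) (xs ! 1))"

lemma all_length_1: "(\<forall>xs. length xs = Suc 0 \<longrightarrow> P xs) \<longleftrightarrow> (\<forall>x. P [x])"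
  by (auto simp: length_Suc_conv)

lemma all_length_2: "(\<forall>xs. length xs = 2 \<longrightarrow> P xs) \<longleftrightarrow> (\<forall>x y. P [x, y])"
  by (auto simp: length_Suc_conv numeral_2_eq_2)

lemma computable_fun_iff: "computable_fun f \<longleftrightarrow> (\<exists>p. \<forall>x. eval p [x] = Some (f x))"
  by (simp add: computable_fun_def computable_on_lists_def all_length_1)

lemma computable_fun2_iff: "computable_fun2 g \<longleftrightarrow> (\<exists>p. \<forall>x y. eval p [x, y] = Some (g x y))"
  by (simp add: computable_fun2_def computable_on_lists_def all_length_2)

section \<open>Closure properties and basic arithmetic\<close>

lemma computable_on_lists_const: "computable_on_lists k (\<lambda>xs. c)"
proof -
  have "eval (rec_nat Zero (\<lambda>_ p. Comp Succ [p]) c) xs = Some c" for xs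
    by (induction c) auto
  then show ?thesis by (auto simp: computable_on_lists_def)
qed

lemma computable_on_lists_nth: "i < k \<Longrightarrow> computable_on_lists k (\<lambda>xs. xs ! i)"
  by (auto simp: computable_on_lists_def intro!: exI[of _ "Proj i"])

lemma computable_on_lists_comp1:
  assumes "computable_fun g" "computable_on_lists k F"
  shows "computable_on_lists k (\<lambda>xs. g (F xs))"
proof -
  obtain p q where "\<forall>x. eval p [x] = Some (g x)" "\<forall>xs. length xs = k \<longrightarrow> eval q xs = Some (F xs)"
    using assms unfolding computable_fun_iff computable_on_lists_def by blast
  then show ?thesis
    by (auto simp: computable_on_lists_def intro!: exI[of _ "Comp p [q]"])
qed

lemma computable_on_lists_comp2:
  assumes "computable_fun2 g" "computable_on_lists k F" "computable_on_lists k G"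
  shows "computable_on_lists k (\<lambda>xs. g (F xs) (G xs))"
proof -
  obtain p q r where "\<forall>x y. eval p [x, y] = Some (g x y)"
    "\<forall>xs. length xs = k \<longrightarrow> eval q xs = Some (F xs)"
    "\<forall>xs. length xs = k \<longrightarrow> eval r xs = Some (G xs)"
    using assms unfolding computable_fun2_iff computable_on_lists_def by blast
  then show ?thesis
    by (auto simp: computable_on_lists_def intro!: exI[of _ "Comp p [q, r]"])
qed

lemma computable_on_lists_rec:
  assumes "computable_on_lists k F" "computable_on_lists (Suc (Suc k)) G"
  shows "computable_on_lists (Suc k) (\<lambda>xs. rec_nat (F (tl xs)) (\<lambda>i r. G (i # r # tl xs)) (hd xs))"
proof -
  obtain p q where p: "\<And>xs. length xs = k \<Longrightarrow> eval p xs = Some (F xs)"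
    and q: "\<And>xs. length xs = Suc (Suc k) \<Longrightarrow> eval q xs = Some (G xs)"
    using assms unfolding computable_on_lists_def by blast
  have "eval (PrimRec p q) (n # ys) = Some (rec_nat (F ys) (\<lambda>i r. G (i # r # ys)) n)"
    if "length ys = k" for n ys
    using that by (induction n) (auto simp: p q)
  then show ?thesis
    unfolding computable_on_lists_def by (intro exI[of _ "PrimRec p q"]) (auto simp: length_Suc_conv simp del: eval.simps)
qed

lemma computable_fun_rec:
  assumes "computable_fun2 g" "\<And>n. rec_nat a g n = f n"
  shows "computable_fun f"
proof -
  have "computable_on_lists (Suc (Suc 0)) (\<lambda>xs. g (xs ! 0) (xs ! 1))"
    using assms(1) by (simp add: computable_fun2_def numeral_2_eq_2)
  from computable_on_lists_rec[OF computable_on_lists_const[of 0 a] this]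
  show ?thesis
    by (auto simp: computable_fun_def computable_on_lists_def all_length_1 assms(2))
qed

lemma computable_fun2_rec:
  assumes "computable_fun f" "computable_on_lists 3 (\<lambda>xs. g (xs ! 0) (xs ! 1) (xs ! 2))"
    "\<And>n y. rec_nat (f y) (\<lambda>k r. g k r y) n = h n y"
  shows "computable_fun2 h"
proof -
  have "computable_on_lists (Suc (Suc (Suc 0))) (\<lambda>xs. g (xs ! 0) (xs ! 1) (xs ! 2))"
    "computable_on_lists (Suc 0) (\<lambda>xs. f (xs ! 0))"
    using assms(1,2) by (simp_all add: computable_fun_def numeral_3_eq_3)
  from computable_on_lists_rec[OF this(2,1)]
  show ?thesis
    by (auto simp: computable_fun2_iff computable_on_lists_def all_length_2 assms(3)
        simp flip: numeral_2_eq_2)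
qed

named_theorems computable

lemmas computable_on_lists_const [computable] computable_on_lists_nth [computable]

lemma computable_fun_Suc: "computable_fun Suc"
  unfolding computable_fun_iff by (intro exI[of _ Succ]) auto

lemmas computable_on_lists_Suc [computable] = computable_on_lists_comp1[OF computable_fun_Suc]

lemma computable_fun2_add: "computable_fun2 (+)"
proof (rule computable_fun2_rec)
  show "rec_nat y (\<lambda>k r. Suc r) n = n + y" for n y by (induction n) auto
qed (unfold computable_fun_def, (intro computable; simp)+)

lemmas computable_on_lists_add [computable] = computable_on_lists_comp2[OF computable_fun2_add]

lemma computable_fun2_mult: "computable_fun2 (*)"
proof (rule computable_fun2_rec)
  show "rec_nat 0 (\<lambda>k r. r + y) n = n * y" for n y :: nat by (induction n) auto
qed (unfold computable_fun_def, (intro computable; simp)+)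

lemmas computable_on_lists_mult [computable] = computable_on_lists_comp2[OF computable_fun2_mult]

lemma computable_fun_pred: "computable_fun (\<lambda>n. n - 1)"
proof (rule computable_fun_rec)
  show "rec_nat 0 (\<lambda>k r. k) n = n - 1" for n :: nat by (induction n) auto
qed (unfold computable_fun2_def, intro computable, auto)

lemma computable_fun2_diff: "computable_fun2 (-)"
proof -
  \<comment> \<open>\<open>PrimRec\<close> recurses on the first argument, so subtraction is
    obtained with its arguments swapped and exchanged afterwards.\<close>
  have "computable_fun2 (\<lambda>n y. y - n)"
  proof (rule computable_fun2_rec)
    show "rec_nat y (\<lambda>k r. r - 1) n = y - n" for n y :: nat by (induction n) auto
  qed (unfold computable_fun_def,
      (intro computable computable_on_lists_comp1[OF computable_fun_pred]; simp)+)
  from computable_on_lists_comp2[OF this, of 2 "\<lambda>xs. xs ! 1" "\<lambda>xs. xs ! 0"] show ?thesis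
    by (simp add: computable_fun2_def computable)
qed

lemmas computable_on_lists_diff [computable] = computable_on_lists_comp2[OF computable_fun2_diff]

lemma computable_on_lists_le [computable]:
  assumes "computable_on_lists k F" "computable_on_lists k G"
  shows "computable_on_lists k (\<lambda>xs. of_bool (F xs \<le> G xs))"
proof -
  have "of_bool (a \<le> b) = 1 - (a - b)" for a b :: nat by auto
  then show ?thesis using assms by (auto intro!: computable)
qed

lemma computable_on_lists_not [computable]:
  assumes "computable_on_lists k (\<lambda>xs. of_bool (P xs))"
  shows "computable_on_lists k (\<lambda>xs. of_bool (\<not> P xs))"
proof -
  have "of_bool (\<not> P xs) = 1 - (of_bool (P xs) :: nat)" for xs by auto
  then show ?thesis using assms by (auto intro!: computable)
qed

lemma computable_on_lists_conj [computable]: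
  assumes "computable_on_lists k (\<lambda>xs. of_bool (P xs))" "computable_on_lists k (\<lambda>xs. of_bool (Q xs))"
  shows "computable_on_lists k (\<lambda>xs. of_bool (P xs \<and> Q xs))"
  unfolding of_bool_conj using assms by (auto intro!: computable)

lemma computable_on_lists_disj [computable]:
  assumes "computable_on_lists k (\<lambda>xs. of_bool (P xs))" "computable_on_lists k (\<lambda>xs. of_bool (Q xs))"
  shows "computable_on_lists k (\<lambda>xs. of_bool (P xs \<or> Q xs))"
  using computable_on_lists_not[OF computable_on_lists_conj[OF assms[THEN computable_on_lists_not]]]
  by simp

lemma computable_on_lists_less [computable]:
  assumes "computable_on_lists k F" "computable_on_lists k G"
  shows "computable_on_lists k (\<lambda>xs. of_bool (F xs < G xs))"
  unfolding not_le[symmetric] using assms by (intro computable)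

lemma computable_on_lists_eq [computable]:
  assumes "computable_on_lists k F" "computable_on_lists k (G :: nat list \<Rightarrow> nat)"
  shows "computable_on_lists k (\<lambda>xs. of_bool (F xs = G xs))"
  unfolding order_eq_iff using assms by (intro computable)

lemma computable_fun_mod2: "computable_fun (\<lambda>n. n mod 2)"
proof (rule computable_fun_rec)
  show "rec_nat 0 (\<lambda>k r. 1 - r) n = n mod 2" for n :: nat
    by (induction n) (auto simp: mod_Suc)
qed (unfold computable_fun2_def, intro computable, auto)

lemmas computable_on_lists_mod2 [computable] = computable_on_lists_comp1[OF computable_fun_mod2]

lemma computable_fun_div2: "computable_fun (\<lambda>n. n div 2)"
proof (rule computable_fun_rec)
  show "rec_nat 0 (\<lambda>k r. r + k mod 2) n = n div 2" for n :: nat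
    by (induction n) (auto, presburger)
qed (unfold computable_fun2_def, intro computable, auto)

lemmas computable_on_lists_div2 [computable] = computable_on_lists_comp1[OF computable_fun_div2]

text \<open>Finite sets of judgements will be coded by their binary expansions. Bit \<open>m\<close>
  is read off by halving \<open>m\<close> times and taking the parity.\<close>

lemma computable_fun2_set_decode: "computable_fun2 (\<lambda>m n. of_bool (m \<in> set_decode n))"
proof -
  have "computable_fun2 (\<lambda>m n. n div 2 ^ m)"
  proof (rule computable_fun2_rec)
    show "rec_nat n (\<lambda>k r. r div 2) m = n div 2 ^ m" for n m :: nat
      by (induction m) (simp_all add: div_mult2_eq power_Suc2 del: power_Suc)
  qed (unfold computable_fun_def, (intro computable; simp)+)
  from computable_on_lists_mod2[OF this[unfolded computable_fun2_def]]
  show ?thesis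
    by (simp add: computable_fun2_def set_decode_def of_bool_odd_eq_mod_2)
qed

lemma computable_fun_triangle: "computable_fun triangle"
  unfolding triangle_def computable_fun_def by (intro computable) auto

lemmas computable_on_lists_triangle [computable] = computable_on_lists_comp1[OF computable_fun_triangle]

lemma computable_fun2_prod_encode: "computable_fun2 (\<lambda>x y. prod_encode (x, y))"
  unfolding prod_encode_def computable_fun2_def split by (intro computable) auto

lemmas computable_on_lists_prod_encode [computable] =
  computable_on_lists_comp2[OF computable_fun2_prod_encode]

text \<open>The antidiagonal of the Cantor pairing on which \<open>z\<close> lies: the greatest
  \<open>k\<close> with \<open>triangle k \<le> z\<close>. It rises by at most one from
  \<open>z\<close> to \<open>Suc z\<close>, which makes it primitive recursive and so gives access
  to the inverse of the pairing.\<close>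

definition diag_index :: "nat \<Rightarrow> nat" where
  "diag_index = rec_nat 0 (\<lambda>z k. k + of_bool (triangle (Suc k) \<le> Suc z))"

lemma mono_triangle: "m \<le> n \<Longrightarrow> triangle m \<le> triangle n"
  unfolding triangle_def by (intro div_le_mono mult_le_mono) auto

lemma diag_index_bounds: "triangle (diag_index z) \<le> z" "z < triangle (Suc (diag_index z))"
  by (induction z) (auto simp: diag_index_def of_bool_def)

lemma diag_index_prod_encode: "diag_index (prod_encode (m, n)) = m + n"
proof -
  let ?z = "prod_encode (m, n)"
  have 1: "triangle (m + n) \<le> ?z" "?z < triangle (Suc (m + n))"
    by (auto simp: prod_encode_def)
  have "\<not> Suc (diag_index ?z) \<le> m + n" "\<not> Suc (m + n) \<le> diag_index ?z"
    using mono_triangle 1 diag_index_bounds[of ?z] by (meson leD le_less_trans less_le_trans)+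
  then show ?thesis by simp
qed

definition pfst :: "nat \<Rightarrow> nat" where "pfst z = fst (prod_decode z)"
definition psnd :: "nat \<Rightarrow> nat" where "psnd z = snd (prod_decode z)"

lemma pfst_prod_encode [simp]: "pfst (prod_encode (m, n)) = m"
  and psnd_prod_encode [simp]: "psnd (prod_encode (m, n)) = n"
  and prod_encode_pfst_psnd [simp]: "prod_encode (pfst z, psnd z) = z"
  by (simp_all add: pfst_def psnd_def)

text \<open>\<open>prod_encode (m, n)\<close> is \<open>triangle (m + n) + m\<close>, so the
  diagonal determines the sum of the components and the offset on it the first one.\<close>

lemma pfst_eq_diag_index: "pfst z = z - triangle (diag_index z)"
  and psnd_eq_diag_index: "psnd z = diag_index z - (z - triangle (diag_index z))"
proof -
  obtain m n where "z = prod_encode (m, n)" by (metis prod_encode_pfst_psnd)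
  then show "pfst z = z - triangle (diag_index z)"
    "psnd z = diag_index z - (z - triangle (diag_index z))"
    by (simp_all only: diag_index_prod_encode pfst_prod_encode psnd_prod_encode)
      (simp_all add: prod_encode_def)
qed

lemma computable_fun_diag_index: "computable_fun diag_index"
  by (rule computable_fun_rec[OF _ diag_index_def[symmetric, THEN fun_cong]])
    (unfold computable_fun2_def, intro computable, auto)

lemmas computable_on_lists_diag_index [computable] =
  computable_on_lists_comp1[OF computable_fun_diag_index]

lemma computable_fun_pfst: "computable_fun pfst"
  unfolding computable_fun_def pfst_eq_diag_index by (intro computable) auto

lemma computable_fun_psnd: "computable_fun psnd"
  unfolding computable_fun_def psnd_eq_diag_index by (intro computable) auto

lemmas computable_on_lists_pfst [computable] = computable_on_lists_comp1[OF computable_fun_pfst]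
lemmas computable_on_lists_psnd [computable] = computable_on_lists_comp1[OF computable_fun_psnd]

lemma computable_on_lists_bex:
  assumes P: "computable_fun (\<lambda>z. of_bool (P (pfst z) (psnd z)))"
    and B: "computable_on_lists k B" and F: "computable_on_lists k F"
  shows "computable_on_lists k (\<lambda>xs. of_bool (\<exists>y<B xs. P y (F xs)))"
proof -
  have "computable_fun2 (\<lambda>n x. of_bool (\<exists>y<n. P y x))"
  proof (rule computable_fun2_rec)
    show "rec_nat 0 (\<lambda>k r. of_bool (r = 1 \<or> P k x)) n = of_bool (\<exists>y<n. P y x)" for n x
      by (induction n) (auto simp: less_Suc_eq)
    have "computable_on_lists 3
      (\<lambda>xs. of_bool (P (pfst (prod_encode (xs ! 0, xs ! 2))) (psnd (prod_encode (xs ! 0, xs ! 2)))))"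
      by (rule computable_on_lists_comp1[OF P]) (auto intro!: computable)
    then have "computable_on_lists 3 (\<lambda>xs. of_bool (P (xs ! 0) (xs ! 2)))"
      by simp
    then show "computable_on_lists 3 (\<lambda>xs. of_bool (xs ! 1 = 1 \<or> P (xs ! 0) (xs ! 2)))"
      by (intro computable) auto
  qed (unfold computable_fun_def, intro computable)
  from computable_on_lists_comp2[OF this B F] show ?thesis .
qed

section \<open>Unary functions, with several arguments packed into a pair\<close>

named_theorems comp_fun

lemma computable_fun_const [comp_fun]: "computable_fun (\<lambda>x. c)"
  unfolding computable_fun_def by (intro computable)

lemma computable_fun_id [comp_fun]: "computable_fun (\<lambda>x. x)"
  unfolding computable_fun_def by (intro computable) auto

lemma computable_fun_comp: "computable_fun g \<Longrightarrow> computable_fun f \<Longrightarrow> computable_fun (\<lambda>x. g (f x))"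
  unfolding computable_fun_def[of f] computable_fun_def[of "\<lambda>x. g (f x)"]
  by (rule computable_on_lists_comp1)

lemma computable_fun_comp2:
  "computable_fun2 g \<Longrightarrow> computable_fun f \<Longrightarrow> computable_fun h \<Longrightarrow> computable_fun (\<lambda>x. g (f x) (h x))"
  unfolding computable_fun_def by (rule computable_on_lists_comp2)

text \<open>Because pairing and both projections are computable, a predicate of several variables
  can be treated as a unary one. This lets a bounded quantifier range over the first component of a
  pair while the parameters sit in the second.\<close>

lemma computable_fun2_uncurry:
  "computable_fun2 g \<longleftrightarrow> computable_fun (\<lambda>z. g (pfst z) (psnd z))"
proof
  assume "computable_fun2 g"
  then show "computable_fun (\<lambda>z. g (pfst z) (psnd z))"
    by (rule computable_fun_comp2[OF _ computable_fun_pfst computable_fun_psnd])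
next
  assume "computable_fun (\<lambda>z. g (pfst z) (psnd z))"
  from computable_on_lists_comp1[OF this computable_fun2_prod_encode[unfolded computable_fun2_def]]
  show "computable_fun2 g" by (simp add: computable_fun2_def)
qed

lemmas [comp_fun] =
  computable_fun_comp[OF computable_fun_Suc] computable_fun_comp[OF computable_fun_pfst]
  computable_fun_comp[OF computable_fun_psnd] computable_fun_comp[OF computable_fun_div2]
  computable_fun_comp2[OF computable_fun2_add] computable_fun_comp2[OF computable_fun2_mult]
  computable_fun_comp2[OF computable_fun2_diff] computable_fun_comp2[OF computable_fun2_prod_encode]
  computable_fun_comp2[OF computable_fun2_set_decode]

lemma computable_pred_intros [comp_fun]:
  "computable_fun f \<Longrightarrow> computable_fun g \<Longrightarrow> computable_fun (\<lambda>x. of_bool (f x = g x))"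
  "computable_fun f \<Longrightarrow> computable_fun g \<Longrightarrow> computable_fun (\<lambda>x. of_bool (f x < g x))"
  "computable_fun (\<lambda>x. of_bool (P x)) \<Longrightarrow> computable_fun (\<lambda>x. of_bool (\<not> P x))"
  "computable_fun (\<lambda>x. of_bool (P x)) \<Longrightarrow> computable_fun (\<lambda>x. of_bool (Q x)) \<Longrightarrow>
    computable_fun (\<lambda>x. of_bool (P x \<and> Q x))"
  "computable_fun (\<lambda>x. of_bool (P x)) \<Longrightarrow> computable_fun (\<lambda>x. of_bool (Q x)) \<Longrightarrow>
    computable_fun (\<lambda>x. of_bool (P x \<or> Q x))"
  unfolding computable_fun_def by (intro computable; assumption)+

lemma computable_fun_bex [comp_fun]:
  assumes "computable_fun B" "computable_fun (\<lambda>z. of_bool (P (pfst z) (psnd z)))"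
  shows "computable_fun (\<lambda>x. of_bool (\<exists>y<B x. P y x))"
  using computable_on_lists_bex[OF assms(2) assms(1)[unfolded computable_fun_def], of "\<lambda>xs. xs ! 0"]
  by (auto simp: computable_fun_def intro: computable)

lemma computable_fun_ball [comp_fun]:
  assumes "computable_fun B" "computable_fun (\<lambda>z. of_bool (P (pfst z) (psnd z)))"
  shows "computable_fun (\<lambda>x. of_bool (\<forall>y<B x. P y x))"
proof -
  have "(\<forall>y<B x. P y x) \<longleftrightarrow> \<not> (\<exists>y<B x. \<not> P y x)" for x by blast
  then show ?thesis using assms by (simp only:) (intro comp_fun)
qed

section \<open>Certificates for computations\<close>

primrec encode_recf :: "recf \<Rightarrow> nat" where
  "encode_recf Zero = prod_encode (0, 0)"
| "encode_recf Succ = prod_encode (1, 0)"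
| "encode_recf (Proj i) = prod_encode (2, i)"
| "encode_recf (Comp f gs) =
     prod_encode (3, prod_encode (encode_recf f, list_encode (map encode_recf gs)))"
| "encode_recf (PrimRec f g) = prod_encode (4, prod_encode (encode_recf f, encode_recf g))"
| "encode_recf (Mu f) = prod_encode (5, encode_recf f)"

text \<open>The value of \<open>list_encode\<close> on a nonempty list with head \<open>x\<close>
  and tail code \<open>y\<close>; the empty list has code 0.\<close>

abbreviation cons_code :: "nat \<Rightarrow> nat \<Rightarrow> nat" where
  "cons_code x y \<equiv> Suc (prod_encode (x, y))"

text \<open>
  A judgement codes a kind \<open>t\<close>, a program \<open>p\<close>, an argument list \<open>x\<close> and a value \<open>v\<close>. Kind \<open>0\<close> says
  that \<open>p\<close> has value \<open>v\<close> on \<open>x\<close>, kind \<open>2\<close> that the list \<open>p\<close> of programs has the list \<open>v\<close> of values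
  on \<open>x\<close>, and kind \<open>3\<close> that \<open>p\<close> has a nonzero value on \<open>y # x\<close> for every \<open>y < v\<close>.
\<close>

definition judgement :: "nat \<Rightarrow> nat \<Rightarrow> nat \<Rightarrow> nat \<Rightarrow> nat" where
  "judgement t p x v = prod_encode (t, prod_encode (p, prod_encode (x, v)))"

lemma judgement_eq [simp]:
  "judgement t p x v = judgement t' p' x' v' \<longleftrightarrow> t = t' \<and> p = p' \<and> x = x' \<and> v = v'"
  by (simp add: judgement_def)

text \<open>
  \<open>inference m a b\<close>: the judgement \<open>m\<close> follows from \<open>a\<close> and \<open>b\<close>. Every premise about the same program
  concerns a smaller recursion argument, so a set of judgements closed under backward inference
  is correct without any bookkeeping of the order of the inferences.
\<close>

inductive inference :: "nat \<Rightarrow> nat \<Rightarrow> nat \<Rightarrow> bool" where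
  Zero: "inference (judgement 0 (prod_encode (0, 0)) x 0) a b"
| Succ: "inference (judgement 0 (prod_encode (1, 0)) (cons_code u 0) (Suc u)) a b"
| Proj_0: "inference (judgement 0 (prod_encode (2, 0)) (cons_code v x) v) a b"
| Proj_Suc: "inference (judgement 0 (prod_encode (2, Suc i)) (cons_code u x) v)
    (judgement 0 (prod_encode (2, i)) x v) b"
| Comp: "inference (judgement 0 (prod_encode (3, prod_encode (f, gs))) x v)
    (judgement 2 gs x ys) (judgement 0 f ys v)"
| Nil: "inference (judgement 2 0 x 0) a b"
| Cons: "inference (judgement 2 (cons_code g gs) x (cons_code y ys))
    (judgement 0 g x y) (judgement 2 gs x ys)"
| PrimRec_0: "inference (judgement 0 (prod_encode (4, prod_encode (f, g))) (cons_code 0 x) v)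
    (judgement 0 f x v) b"
| PrimRec_Suc: "inference
    (judgement 0 (prod_encode (4, prod_encode (f, g))) (cons_code (Suc k) x) v)
    (judgement 0 (prod_encode (4, prod_encode (f, g))) (cons_code k x) w)
    (judgement 0 g (cons_code k (cons_code w x)) v)"
| Mu: "inference (judgement 0 (prod_encode (5, f)) x v)
    (judgement 0 f (cons_code v x) 0) (judgement 3 f x v)"
| Below_0: "inference (judgement 3 f x 0) a b"
| Below_Suc: "inference (judgement 3 f x (Suc y))
    (judgement 0 f (cons_code y x) (Suc w)) (judgement 3 f x y)"

definition backward_closed :: "nat set \<Rightarrow> bool" where
  "backward_closed F \<longleftrightarrow> (\<forall>m\<in>F. \<exists>a\<in>F. \<exists>b\<in>F. inference m a b)"

definition derivable :: "nat \<Rightarrow> bool" where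
  "derivable m \<longleftrightarrow> (\<exists>F. finite F \<and> backward_closed F \<and> m \<in> F)"

text \<open>A union of backward closed sets is backward closed, and so is its extension by a
  judgement whose premises it contains. Allowing a premise to be \<open>m\<close> itself fills the
  idle premise slots of axioms and one-premise rules.\<close>

lemma derivableI:
  assumes "inference m a b" "a = m \<or> derivable a" "b = m \<or> derivable b"
  shows "derivable m"
proof -
  have *: "\<exists>A. finite A \<and> backward_closed A \<and> (c = m \<or> c \<in> A)" if "c = m \<or> derivable c" for c
    using that
  proof
    assume "c = m"
    then show ?thesis by (intro exI[of _ "{}"]) (simp add: backward_closed_def)
  qed (auto simp: derivable_def)
  obtain A where A: "finite A" "backward_closed A" "a = m \<or> a \<in> A"
    using *[OF assms(2)] by blast
  obtain B where B: "finite B" "backward_closed B" "b = m \<or> b \<in> B"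
    using *[OF assms(3)] by blast
  let ?F = "insert m (A \<union> B)"
  have "\<exists>a\<in>?F. \<exists>b\<in>?F. inference n a b" if n: "n \<in> ?F" for n
  proof -
    consider "n = m" | "n \<in> A" | "n \<in> B" using n by blast
    then show ?thesis
    proof cases
      case 1
      then show ?thesis using assms(1) A(3) B(3) by blast
    next
      case 2
      then show ?thesis using A(2) unfolding backward_closed_def by blast
    next
      case 3
      then show ?thesis using B(2) unfolding backward_closed_def by blast
    qed
  qed
  then have "finite ?F \<and> backward_closed ?F \<and> m \<in> ?F"
    using A(1) B(1) by (simp add: backward_closed_def)
  then show ?thesis
    unfolding derivable_def by (rule exI)
qed

lemma derivable_axiom: "(\<And>a b. inference m a b) \<Longrightarrow> derivable m"
  by (rule derivableI[of m m m]) simp_all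

lemma derivable_step1: "(\<And>b. inference m a b) \<Longrightarrow> derivable a \<Longrightarrow> derivable m"
  by (rule derivableI[of m a m]) simp_all

lemma derivable_step2: "inference m a b \<Longrightarrow> derivable a \<Longrightarrow> derivable b \<Longrightarrow> derivable m"
  by (rule derivableI[of m a b]) simp_all

lemma list_encode_eq_0: "list_encode xs = 0 \<longleftrightarrow> xs = []"
  by (cases xs) auto

lemma list_encode_eq_cons_code:
  "list_encode xs = cons_code u x \<longleftrightarrow> (\<exists>ys. xs = u # ys \<and> x = list_encode ys)"
  by (cases xs) auto

text \<open>The first assumption is the induction hypothesis for the subprograms of a composition,
  passed on to an induction over their list.\<close>

lemma derivable_list:
  assumes "\<And>g v. g \<in> set gs \<Longrightarrow> eval g xs = Some v \<Longrightarrow>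
      derivable (judgement 0 (encode_recf g) (list_encode xs) v)"
    and "those (map (\<lambda>g. eval g xs) gs) = Some ys"
  shows "derivable (judgement 2 (list_encode (map encode_recf gs)) (list_encode xs) (list_encode ys))"
  using assms
proof (induction gs arbitrary: ys)
  case Nil
  then show ?case by (simp add: derivable_axiom[OF inference.Nil])
next
  case (Cons g gs)
  then obtain y ys' where y: "eval g xs = Some y" "ys = y # ys'"
    "those (map (\<lambda>g. eval g xs) gs) = Some ys'"
    by (auto split: option.splits)
  moreover have "derivable (judgement 0 (encode_recf g) (list_encode xs) y)"
    by (rule Cons.prems(1)) (simp_all add: y(1))
  moreover have "derivable (judgement 2 (list_encode (map encode_recf gs)) (list_encode xs) (list_encode ys'))"
    by (rule Cons.IH[OF Cons.prems(1) y(3)]) simp_all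
  ultimately show ?case
    by (simp add: derivable_step2[OF inference.Cons])
qed

text \<open>Completeness: each clause of \<open>eval\<close> is mirrored by a rule. Inside the
  induction on programs there are inductions on the projection index, on the recursion argument and
  on the values tried by a search.\<close>

lemma derivable_if_eval:
  "eval p xs = Some v \<Longrightarrow> derivable (judgement 0 (encode_recf p) (list_encode xs) v)"
proof (induction p arbitrary: xs v)
  case Zero
  then show ?case by (simp add: derivable_axiom[OF inference.Zero])
next
  case Succ
  then show ?case
    by (auto split: list.splits simp: derivable_axiom[OF inference.Succ[unfolded One_nat_def]])
next
  case (Proj i)
  then show ?case
  proof (induction i arbitrary: xs)
    case 0
    then obtain y ys where "xs = y # ys" by (cases xs) auto
    with 0 show ?case by (simp add: derivable_axiom[OF inference.Proj_0])
  next
    case (Suc i)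
    then obtain y ys where xs: "xs = y # ys" by (cases xs) auto
    then have "eval (Proj i) ys = Some v" using Suc.prems by (auto split: if_splits)
    from Suc.IH[OF this] show ?case
      unfolding xs by (simp add: derivable_step1[OF inference.Proj_Suc])
  qed
next
  case (Comp f gs)
  then obtain ys where "those (map (\<lambda>g. eval g xs) gs) = Some ys" "eval f ys = Some v"
    by (auto simp: bind_eq_Some_conv)
  then show ?case
    using derivable_step2[OF inference.Comp derivable_list[OF Comp.IH(2)] Comp.IH(1)] by simp
next
  case (PrimRec f g)
  then obtain n ys where xs: "xs = n # ys" by (cases xs) auto
  have "derivable (judgement 0 (encode_recf (PrimRec f g)) (list_encode (n # ys)) v)"
    if "eval (PrimRec f g) (n # ys) = Some v"
    using that
  proof (induction n arbitrary: v)
    case 0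
    then show ?case using PrimRec.IH(1)[of ys v] by (simp add: derivable_step1[OF inference.PrimRec_0])
  next
    case (Suc n)
    then obtain w where w: "eval (PrimRec f g) (n # ys) = Some w" "eval g (n # w # ys) = Some v"
      by (auto simp: bind_eq_Some_conv)
    show ?case
      using derivable_step2[OF inference.PrimRec_Suc] Suc.IH[OF w(1)] PrimRec.IH(2)[OF w(2)]
      by simp
  qed
  then show ?case using PrimRec.prems unfolding xs by blast
next
  case (Mu f)
  let ?P = "\<lambda>z. eval f (z # xs) = Some 0 \<and> (\<forall>y<z. eval f (y # xs) \<noteq> None)"
  obtain z where z: "?P z" and v: "v = (LEAST z. eval f (z # xs) = Some 0)"
    using Mu.prems by (auto split: if_splits)
  have 0: "eval f (v # xs) = Some 0" and le: "v \<le> z"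
    unfolding v by (rule LeastI, use z in blast, rule Least_le, use z in blast)
  \<comment> \<open>Below the least zero \<open>v\<close> every value is defined, because
    \<open>v \<le> z\<close>, and nonzero, by minimality. The rule \<open>Below_Suc\<close> asks for
    both.\<close>
  have pos: "\<exists>w. eval f (y # xs) = Some (Suc w)" if "y < v" for y
  proof -
    have "eval f (y # xs) \<noteq> Some 0" using that unfolding v by (rule not_less_Least)
    moreover obtain u where "eval f (y # xs) = Some u"
      using z order.strict_trans2[OF \<open>y < v\<close> le] by blast
    ultimately show ?thesis by (cases u) auto
  qed
  have "derivable (judgement 3 (encode_recf f) (list_encode xs) y)" if "y \<le> v" for y
    using that
  proof (induction y)
    case 0
    then show ?case by (simp add: derivable_axiom[OF inference.Below_0])
  next
    case (Suc y)
    then obtain w where "eval f (y # xs) = Some (Suc w)" using pos[of y] by auto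
    from derivable_step2[OF inference.Below_Suc] Mu.IH[OF this] Suc show ?case
      by simp
  qed
  then show ?case
    using derivable_step2[OF inference.Mu] Mu.IH[OF 0] by simp
qed

lemma eval_list_if_backward_closed:
  assumes F: "backward_closed F"
    and IH: "\<And>g v. g \<in> set gs \<Longrightarrow> judgement 0 (encode_recf g) (list_encode xs) v \<in> F \<Longrightarrow>
      eval g xs = Some v"
    and "judgement 2 (list_encode (map encode_recf gs)) (list_encode xs) y \<in> F"
  shows "\<exists>ys. y = list_encode ys \<and> those (map (\<lambda>g. eval g xs) gs) = Some ys"
  using IH assms(3)
proof (induction gs arbitrary: y)
  case Nil
  then obtain a b where "inference (judgement 2 0 (list_encode xs) y) a b"
    using F unfolding backward_closed_def by fastforce
  then show ?case by cases auto
next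
  case (Cons g gs)
  then obtain a b where ab: "a \<in> F" "b \<in> F"
    "inference (judgement 2 (list_encode (map encode_recf (g # gs))) (list_encode xs) y) a b"
    using F unfolding backward_closed_def by blast
  from ab(3,1,2) obtain z zs where z: "y = cons_code z zs" "judgement 0 (encode_recf g) (list_encode xs) z \<in> F"
    "judgement 2 (list_encode (map encode_recf gs)) (list_encode xs) zs \<in> F"
    by cases auto
  then obtain ys where "zs = list_encode ys" "those (map (\<lambda>g. eval g xs) gs) = Some ys"
    using Cons.IH[OF Cons.prems(1) z(3)] by auto
  then show ?case
    using z Cons.prems(1) by (intro exI[of _ "z # ys"]) auto
qed

text \<open>Soundness, without extracting a derivation tree from \<open>F\<close>: the induction
  follows the program, and inner inductions on the projection index, the recursion argument and the
  search bound handle the premises that are not about a subprogram.\<close>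

lemma eval_if_backward_closed:
  assumes F: "backward_closed F"
    and "judgement 0 (encode_recf p) (list_encode xs) v \<in> F"
  shows "eval p xs = Some v"
  using assms(2)
proof (induction p arbitrary: xs v)
  case Zero
  then obtain a b where "inference (judgement 0 (encode_recf Zero) (list_encode xs) v) a b"
    using F unfolding backward_closed_def by blast
  then show ?case by cases auto
next
  case Succ
  then obtain a b where "inference (judgement 0 (encode_recf Succ) (list_encode xs) v) a b"
    using F unfolding backward_closed_def by blast
  then show ?case by cases (auto simp: list_encode_eq_cons_code list_encode_eq_0)
next
  case (Proj i)
  then show ?case
  proof (induction i arbitrary: xs)
    case 0
    then obtain a b where "inference (judgement 0 (encode_recf (Proj 0)) (list_encode xs) v) a b"
      using F unfolding backward_closed_def by blast
    then show ?case by cases (auto simp: list_encode_eq_cons_code)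
  next
    case (Suc i)
    then obtain a b where "a \<in> F" "b \<in> F"
      "inference (judgement 0 (encode_recf (Proj (Suc i))) (list_encode xs) v) a b"
      using F unfolding backward_closed_def by blast
    from this(3,1,2) obtain u ys where "xs = u # ys" "judgement 0 (encode_recf (Proj i)) (list_encode ys) v \<in> F"
      by cases (auto simp: list_encode_eq_cons_code)
    with Suc.IH[of ys] show ?case by (auto split: if_splits)
  qed
next
  case (Comp f gs)
  then obtain a b where ab: "a \<in> F" "b \<in> F"
    "inference (judgement 0 (encode_recf (Comp f gs)) (list_encode xs) v) a b"
    using F unfolding backward_closed_def by blast
  from ab(3,1,2) obtain y where y: "judgement 2 (list_encode (map encode_recf gs)) (list_encode xs) y \<in> F"
    "judgement 0 (encode_recf f) y v \<in> F"
    by cases auto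
  then obtain ys where "y = list_encode ys" "those (map (\<lambda>g. eval g xs) gs) = Some ys"
    using eval_list_if_backward_closed[OF F Comp.IH(2) y(1)] by blast
  then show ?case using Comp.IH(1) y(2) by auto
next
  case (PrimRec f g)
  have step: "\<exists>a\<in>F. \<exists>b\<in>F. inference (judgement 0 (encode_recf (PrimRec f g)) (list_encode xs) v) a b"
    if "judgement 0 (encode_recf (PrimRec f g)) (list_encode xs) v \<in> F" for xs v
    using that F unfolding backward_closed_def by blast
  from step[OF PrimRec.prems] obtain n ys where xs: "xs = n # ys"
    by (elim bexE inference.cases) (auto simp: list_encode_eq_cons_code)
  have "eval (PrimRec f g) (n # ys) = Some v"
    if "judgement 0 (encode_recf (PrimRec f g)) (list_encode (n # ys)) v \<in> F"
    using that
  proof (induction n arbitrary: v)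
    case 0
    from step[OF 0] have "judgement 0 (encode_recf f) (list_encode ys) v \<in> F"
      by (elim bexE inference.cases) auto
    then show ?case using PrimRec.IH(1) by auto
  next
    case (Suc n)
    from step[OF Suc.prems] obtain w where
      "judgement 0 (encode_recf (PrimRec f g)) (list_encode (n # ys)) w \<in> F"
      "judgement 0 (encode_recf g) (list_encode (n # w # ys)) v \<in> F"
      by (elim bexE inference.cases) auto
    with Suc.IH PrimRec.IH(2) have "eval (PrimRec f g) (n # ys) = Some w" "eval g (n # w # ys) = Some v"
      by blast+
    then show ?case by simp
  qed
  then show ?case using PrimRec.prems unfolding xs by blast
next
  case (Mu f)
  then obtain a b where ab: "a \<in> F" "b \<in> F"
    "inference (judgement 0 (encode_recf (Mu f)) (list_encode xs) v) a b"
    using F unfolding backward_closed_def by blast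
  from ab(3,1,2) have v: "judgement 0 (encode_recf f) (list_encode (v # xs)) 0 \<in> F \<and>
    judgement 3 (encode_recf f) (list_encode xs) v \<in> F"
    by cases auto
  have pos: "\<exists>w. eval f (y # xs) = Some (Suc w)"
    if "judgement 3 (encode_recf f) (list_encode xs) z \<in> F" "y < z" for y z
    using that
  proof (induction z)
    case (Suc z)
    then obtain a b where ab: "a \<in> F" "b \<in> F"
      "inference (judgement 3 (encode_recf f) (list_encode xs) (Suc z)) a b"
      using F unfolding backward_closed_def by blast
    from ab(3,1,2) obtain w where w: "judgement 0 (encode_recf f) (list_encode (z # xs)) (Suc w) \<in> F"
      "judgement 3 (encode_recf f) (list_encode xs) z \<in> F"
      by cases auto
    show ?case
    proof (cases "y = z")
      case True
      then show ?thesis using Mu.IH[OF w(1)] by blast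
    next
      case False
      then show ?thesis using Suc.IH[OF w(2)] Suc.prems(2) by simp
    qed
  qed simp
  have 0: "eval f (v # xs) = Some 0" by (rule Mu.IH[OF conjunct1[OF v]])
  \<comment> \<open>The kind 3 premise makes all values below \<open>v\<close> nonzero, so the zero
    at \<open>v\<close> is the first one.\<close>
  have "(LEAST z. eval f (z # xs) = Some 0) = v"
  proof (rule Least_equality[where P = "\<lambda>z. eval f (z # xs) = Some 0", OF 0])
    show "v \<le> y" if "eval f (y # xs) = Some 0" for y
      using pos[OF conjunct2[OF v], of y] that by (cases "y < v") auto
  qed
  moreover have "\<forall>y<v. eval f (y # xs) \<noteq> None" using pos[OF conjunct2[OF v]] by force
  ultimately show ?case using 0 by auto
qed

section \<open>Decidability of certificates\<close>

definition kind_of :: "nat \<Rightarrow> nat" where "kind_of m = pfst m"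
definition prog_of :: "nat \<Rightarrow> nat" where "prog_of m = pfst (psnd m)"
definition args_of :: "nat \<Rightarrow> nat" where "args_of m = pfst (psnd (psnd m))"
definition val_of :: "nat \<Rightarrow> nat" where "val_of m = psnd (psnd (psnd m))"

lemma judgement_sel [simp]:
  "kind_of (judgement t p x v) = t" "prog_of (judgement t p x v) = p"
  "args_of (judgement t p x v) = x" "val_of (judgement t p x v) = v"
  by (simp_all add: judgement_def kind_of_def prog_of_def args_of_def val_of_def)

lemma judgement_collapse: "judgement (kind_of m) (prog_of m) (args_of m) (val_of m) = m"
  by (simp add: judgement_def kind_of_def prog_of_def args_of_def val_of_def)

abbreviation hd_code :: "nat \<Rightarrow> nat" where "hd_code x \<equiv> pfst (x - 1)"
abbreviation tl_code :: "nat \<Rightarrow> nat" where "tl_code x \<equiv> psnd (x - 1)"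

text \<open>
  A quantifier-free form of the rules, from which decidability can be read off: every variable is
  replaced by the projection that recovers it.
\<close>

lemma inference_iff:
  "inference m a b \<longleftrightarrow>
     m = judgement 0 (prod_encode (0, 0)) (args_of m) 0 \<or>
     m = judgement 0 (prod_encode (1, 0)) (cons_code (hd_code (args_of m)) 0)
       (Suc (hd_code (args_of m))) \<or>
     m = judgement 0 (prod_encode (2, 0)) (cons_code (val_of m) (tl_code (args_of m))) (val_of m) \<or>
     m = judgement 0 (prod_encode (2, Suc (psnd (prog_of a))))
       (cons_code (hd_code (args_of m)) (args_of a)) (val_of a) \<and>
       kind_of a = 0 \<and> pfst (prog_of a) = 2 \<or>
     m = judgement 0 (prod_encode (3, prod_encode (prog_of b, prog_of a))) (args_of a) (val_of b) \<and>
       kind_of a = 2 \<and> kind_of b = 0 \<and> args_of b = val_of a \<or>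
     m = judgement 2 0 (args_of m) 0 \<or>
     m = judgement 2 (cons_code (prog_of a) (prog_of b)) (args_of a)
       (cons_code (val_of a) (val_of b)) \<and>
       kind_of a = 0 \<and> kind_of b = 2 \<and> args_of b = args_of a \<or>
     m = judgement 0 (prod_encode (4, prod_encode (prog_of a, psnd (psnd (prog_of m)))))
       (cons_code 0 (args_of a)) (val_of a) \<and> kind_of a = 0 \<or>
     m = judgement 0 (prog_of a)
       (cons_code (Suc (hd_code (args_of a))) (tl_code (args_of a))) (val_of b) \<and>
       kind_of a = 0 \<and> pfst (prog_of a) = 4 \<and> 0 < args_of a \<and>
       b = judgement 0 (psnd (psnd (prog_of a)))
         (cons_code (hd_code (args_of a)) (cons_code (val_of a) (tl_code (args_of a)))) (val_of b) \<or>
     m = judgement 0 (prod_encode (5, prog_of b)) (args_of b) (val_of b) \<and> kind_of b = 3 \<and>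
       a = judgement 0 (prog_of b) (cons_code (val_of b) (args_of b)) 0 \<or>
     m = judgement 3 (prog_of m) (args_of m) 0 \<or>
     m = judgement 3 (prog_of b) (args_of b) (Suc (val_of b)) \<and> kind_of b = 3 \<and>
       a = judgement 0 (prog_of b) (cons_code (val_of b) (args_of b)) (val_of a) \<and> 0 < val_of a"
  (is "_ = ?R")
proof
  show "inference m a b \<Longrightarrow> ?R"
    by (erule inference.cases; simp only: judgement_sel judgement_eq; simp)
next
  \<comment> \<open>The first premise is taken apart down to the components of its program, since
    the rules \<open>Proj_Suc\<close> and \<open>PrimRec_Suc\<close> inspect the tag and the parts
    of that program.\<close>
  obtain t c d e x v where a: "a = judgement t (prod_encode (c, prod_encode (d, e))) x v"
    by (metis judgement_collapse prod_encode_pfst_psnd)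
  obtain t' p' x' v' where b: "b = judgement t' p' x' v'" by (metis judgement_collapse)
  assume ?R
  then show "inference m a b"
  proof (elim disjE, goal_cases)
    case 1 then show ?case by (metis inference.Zero)
  next
    case 2 then show ?case by (metis inference.Succ)
  next
    case 3 then show ?case by (metis inference.Proj_0)
  next
    case 4 then show ?case unfolding a b by (elim conjE) (erule ssubst, auto intro: inference.Proj_Suc)
  next
    case 5 then show ?case unfolding a b by (elim conjE) (erule ssubst, auto intro: inference.Comp)
  next
    case 6 then show ?case by (metis inference.Nil)
  next
    case 7 then show ?case unfolding a b by (elim conjE) (erule ssubst, auto intro: inference.Cons)
  next
    case 8 then show ?case unfolding a b by (elim conjE) (erule ssubst, auto intro: inference.PrimRec_0)
  next
    case 9
    \<comment> \<open>Positivity excludes the empty argument list, on whose code 0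
      \<open>hd_code\<close> and \<open>tl_code\<close> would still return something because
      \<open>0 - 1 = 0\<close>.\<close>
    then have "0 < x" by (simp add: a)
    then obtain k y where x: "x = cons_code k y" by (metis prod_encode_pfst_psnd Suc_pred)
    from 9 show ?case
      unfolding a b x by (elim conjE) (erule ssubst, auto intro: inference.PrimRec_Suc)
  next
    case 10 then show ?case unfolding a b by (elim conjE) (erule ssubst, auto intro: inference.Mu)
  next
    case 11 then show ?case by (metis inference.Below_0)
  next
    case 12
    then have "0 < v" by (simp add: a)
    then obtain w where v: "v = Suc w" by (cases v) auto
    from 12 show ?case
      unfolding a b v by (elim conjE) (erule ssubst, auto intro: inference.Below_Suc)
  qed
qed

lemma less_if_mem_set_decode: "m \<in> set_decode n \<Longrightarrow> m < n"
proof -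
  assume "m \<in> set_decode n"
  then have "2 ^ m \<le> n" by (auto simp: set_decode_def intro: ccontr)
  then show ?thesis by (rule less_le_trans[OF less_exp])
qed

text \<open>Members of a coded set are smaller than its code, so all quantifiers can be bounded by
  \<open>n\<close> and the property becomes decidable.\<close>

lemma backward_closed_set_decode:
  "backward_closed (set_decode n) \<longleftrightarrow>
    (\<forall>m<n. m \<notin> set_decode n \<or>
      (\<exists>a<n. a \<in> set_decode n \<and> (\<exists>b<n. b \<in> set_decode n \<and> inference m a b)))"
  unfolding backward_closed_def using less_if_mem_set_decode by blast

lemma computable_backward_closed:
  "computable_fun (\<lambda>n. of_bool (backward_closed (set_decode n)))"
  unfolding backward_closed_set_decode inference_iff judgement_def kind_of_def prog_of_def args_of_def val_of_def
  by (intro comp_fun)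

text \<open>\<open>n\<close> certifies that program \<open>e\<close> returns 0 on its own code;
  \<open>cons_code e 0\<close> is the code of the one-element list containing \<open>e\<close>.
  Asking for the value 0 instead of mere convergence allows a direct diagonalisation against
  0-1-valued decision programs.\<close>

definition halting_certificate :: "nat \<Rightarrow> nat \<Rightarrow> bool" where
  "halting_certificate e n \<longleftrightarrow>
    backward_closed (set_decode n) \<and> judgement 0 e (cons_code e 0) 0 \<in> set_decode n"

lemma halting_certificate_iff:
  "(\<exists>n. halting_certificate (encode_recf p) n) \<longleftrightarrow> eval p [encode_recf p] = Some 0"
proof
  assume "\<exists>n. halting_certificate (encode_recf p) n"
  then show "eval p [encode_recf p] = Some 0"
    unfolding halting_certificate_def by (auto intro!: eval_if_backward_closed)
next
  assume "eval p [encode_recf p] = Some 0"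
  from derivable_if_eval[OF this] obtain F where
    "finite F" "backward_closed F" "judgement 0 (encode_recf p) (cons_code (encode_recf p) 0) 0 \<in> F"
    unfolding derivable_def by auto
  then show "\<exists>n. halting_certificate (encode_recf p) n"
    unfolding halting_certificate_def by (intro exI[of _ "set_encode F"]) simp
qed

text \<open>A decision program, run on its own code, would return 0 exactly when a certificate
  exists, that is, exactly when it ought to return 1.\<close>

lemma not_computable_halting: "\<not> computable_fun (\<lambda>e. of_bool (\<exists>n. halting_certificate e n))"
proof
  assume "computable_fun (\<lambda>e. of_bool (\<exists>n. halting_certificate e n))"
  then obtain p where "\<And>e. eval p [e] = Some (of_bool (\<exists>n. halting_certificate e n))"
    unfolding computable_fun_iff by blast
  from this[of "encode_recf p"] show False
    unfolding halting_certificate_iff by (auto split: if_splits simp: of_bool_def)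
qed

lemma computable_halting_certificate:
  "computable_fun (\<lambda>z. of_bool (halting_certificate (pfst z) (psnd z)))"
  unfolding halting_certificate_def judgement_def
  by (intro comp_fun computable_fun_comp[OF computable_backward_closed])

text \<open>Minimality gives each \<open>e\<close> at most one such \<open>n\<close>, hence the
  order at most one element of rank \<open>2 * e + 1\<close>.\<close>

definition first_certificate :: "nat \<Rightarrow> nat \<Rightarrow> bool" where
  "first_certificate e n \<longleftrightarrow> halting_certificate e n \<and> (\<forall>k<n. \<not> halting_certificate e k)"

lemma ex_first_certificate: "(\<exists>n. first_certificate e n) \<longleftrightarrow> (\<exists>n. halting_certificate e n)"
  unfolding first_certificate_def by (meson exists_least_iff)

lemma first_certificate_unique: "first_certificate e n \<Longrightarrow> first_certificate e k \<Longrightarrow> n = k"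
  unfolding first_certificate_def by (meson linorder_neqE_nat)

text \<open>The number 0 codes the empty set. So a second component 0 remains free to mark the
  elements of even rank.\<close>

lemma not_first_certificate_0: "\<not> first_certificate e 0"
  by (simp add: first_certificate_def halting_certificate_def)

lemma computable_first_certificate:
  "computable_fun (\<lambda>z. of_bool (first_certificate (pfst z) (psnd z)))"
proof -
  \<comment> \<open>Substituting a pair for the variable gives the decidability of
    \<open>halting_certificate\<close> at arbitrary computable arguments.\<close>
  note * = computable_fun_comp[OF computable_halting_certificate, of "\<lambda>z. prod_encode (f z, g z)" for f g,
      unfolded pfst_prod_encode psnd_prod_encode]
  show ?thesis
    unfolding first_certificate_def by (intro comp_fun *)
qed

section \<open>Countable dense orders and the order-type \<open>\<omega> + \<zeta>\<eta>\<close>\<close>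

definition dense_unbounded :: "'a set \<Rightarrow> 'a rel \<Rightarrow> bool" where
  "dense_unbounded A r \<longleftrightarrow> A \<noteq> {} \<and> trans r \<and> irrefl r \<and> total_on A r \<and>
     (\<forall>x\<in>A. (\<exists>y\<in>A. (y, x) \<in> r) \<and> (\<exists>y\<in>A. (x, y) \<in> r)) \<and>
     (\<forall>x\<in>A. \<forall>y\<in>A. (x, y) \<in> r \<longrightarrow> (\<exists>z\<in>A. (x, z) \<in> r \<and> (z, y) \<in> r))"

lemma dense_unbounded_converse: "dense_unbounded A r \<Longrightarrow> dense_unbounded A (r\<inverse>)"
  unfolding dense_unbounded_def by (simp add: irrefl_def) blast

lemma finite_greatest:
  assumes "finite X" "X \<noteq> {}" "X \<subseteq> A" "trans r" "irrefl r" "total_on A r"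
  shows "\<exists>m\<in>X. \<forall>x\<in>X. x = m \<or> (x, m) \<in> r"
  using assms(1-3)
proof (induction X rule: finite_ne_induct)
  case (insert x X)
  then obtain m where m: "m \<in> X" "\<And>y. y \<in> X \<Longrightarrow> y = m \<or> (y, m) \<in> r" by auto
  have "x \<in> A" "m \<in> A" using insert.prems m(1) by auto
  then consider "x = m \<or> (x, m) \<in> r" | "(m, x) \<in> r"
    using assms(6) unfolding total_on_def by blast
  then show ?case
  proof cases
    case 1
    then have "\<forall>y\<in>insert x X. y = m \<or> (y, m) \<in> r" using m(2) by auto
    then show ?thesis using m(1) by (intro bexI[of _ m]) auto
  next
    case 2
    then have "\<forall>y\<in>insert x X. y = x \<or> (y, x) \<in> r" using m(2) transD[OF assms(4)] by auto
    then show ?thesis by (intro bexI[of _ x]) auto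
  qed
qed simp

text \<open>Only the greatest element of \<open>X\<close> and the least element of \<open>Y\<close>
  constrain \<open>z\<close>. Density applies if both exist, and unboundedness or nonemptiness of
  \<open>A\<close> otherwise.\<close>

lemma dense_unbounded_between:
  assumes d: "dense_unbounded A r" and "finite X" "finite Y" "X \<subseteq> A" "Y \<subseteq> A"
    and XY: "\<And>x y. x \<in> X \<Longrightarrow> y \<in> Y \<Longrightarrow> (x, y) \<in> r"
  shows "\<exists>z\<in>A. (\<forall>x\<in>X. (x, z) \<in> r) \<and> (\<forall>y\<in>Y. (z, y) \<in> r)"
proof -
  have tr: "trans r" and ir: "irrefl r" and tot: "total_on A r" and ne: "A \<noteq> {}"
    using d by (simp_all add: dense_unbounded_def)
  have tr': "trans (r\<inverse>)" and ir': "irrefl (r\<inverse>)" and tot': "total_on A (r\<inverse>)"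
    using dense_unbounded_converse[OF d] by (simp_all add: dense_unbounded_def)
  \<comment> \<open>\<open>finite_greatest\<close> is used for \<open>r\<close> and for its
    converse, giving a greatest \<open>a\<close> in \<open>X\<close> and a least \<open>b\<close> in
    \<open>Y\<close>.\<close>
  have "\<exists>a b. (X = {} \<or> a \<in> X \<and> (\<forall>x\<in>X. x = a \<or> (x, a) \<in> r)) \<and>
      (Y = {} \<or> b \<in> Y \<and> (\<forall>y\<in>Y. y = b \<or> (b, y) \<in> r))"
    using finite_greatest[OF \<open>finite X\<close> _ \<open>X \<subseteq> A\<close> tr ir tot]
      finite_greatest[OF \<open>finite Y\<close> _ \<open>Y \<subseteq> A\<close> tr' ir' tot'] by simp metis
  then obtain a b where a: "X = {} \<or> a \<in> X \<and> (\<forall>x\<in>X. x = a \<or> (x, a) \<in> r)"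
    and b: "Y = {} \<or> b \<in> Y \<and> (\<forall>y\<in>Y. y = b \<or> (b, y) \<in> r)" by blast
  have "\<exists>z\<in>A. (X \<noteq> {} \<longrightarrow> (a, z) \<in> r) \<and> (Y \<noteq> {} \<longrightarrow> (z, b) \<in> r)"
  proof (cases "X = {}")
    case True
    then show ?thesis using d b \<open>Y \<subseteq> A\<close> ne unfolding dense_unbounded_def by (metis ex_in_conv subsetD)
  next
    case False
    then have aA: "a \<in> X" "a \<in> A" using a \<open>X \<subseteq> A\<close> by auto
    show ?thesis
    proof (cases "Y = {}")
      case True
      then show ?thesis using d aA unfolding dense_unbounded_def by metis
    next
      case False
      then have "b \<in> Y" "b \<in> A" using b \<open>Y \<subseteq> A\<close> by auto
      then show ?thesis using d aA XY[of a b] unfolding dense_unbounded_def by metis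
    qed
  qed
  then obtain z where "z \<in> A" "X \<noteq> {} \<Longrightarrow> (a, z) \<in> r" "Y \<noteq> {} \<Longrightarrow> (z, b) \<in> r" by blast
  then show ?thesis using a b tr by (intro bexI[of _ z] conjI ballI) (metis ex_in_conv transE)+
qed

section \<open>Cantor's theorem by back-and-forth\<close>

definition partial_iso :: "'a set \<Rightarrow> 'a rel \<Rightarrow> 'b set \<Rightarrow> 'b rel \<Rightarrow> ('a \<times> 'b) set \<Rightarrow> bool" where
  "partial_iso A r B s f \<longleftrightarrow> finite f \<and> f \<subseteq> A \<times> B \<and>
     (\<forall>(a, b)\<in>f. \<forall>(a', b')\<in>f. (a = a' \<longleftrightarrow> b = b') \<and> ((a, a') \<in> r \<longleftrightarrow> (b, b') \<in> s))"

lemma partial_iso_converse: "partial_iso A r B s f \<Longrightarrow> partial_iso B s A r (f\<inverse>)"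
  unfolding partial_iso_def by fastforce

text \<open>The partners of points below \<open>a\<close> lie below the partners of points above
  \<open>a\<close>, so the dense order \<open>B\<close> has room for a partner of \<open>a\<close>.
  With the roles of the two orders exchanged, this is also the "back" step.\<close>

lemma partial_iso_extend:
  assumes A: "trans r" "irrefl r" "total_on A r" and B: "dense_unbounded B s"
    and f: "partial_iso A r B s f" and a: "a \<in> A"
  shows "\<exists>b\<in>B. partial_iso A r B s (insert (a, b) f)"
proof (cases "a \<in> Domain f")
  case True
  then obtain b where "(a, b) \<in> f" by blast
  then show ?thesis using f by (auto simp: partial_iso_def insert_absorb intro!: bexI[of _ b])
next
  case False
  define X where "X = {b. \<exists>x. (x, b) \<in> f \<and> (x, a) \<in> r}"
  define Y where "Y = {b. \<exists>x. (x, b) \<in> f \<and> (a, x) \<in> r}"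
  have fin: "finite f" and sub: "f \<subseteq> A \<times> B"
    and iso: "\<And>x y x' y'. (x, y) \<in> f \<Longrightarrow> (x', y') \<in> f \<Longrightarrow> (x, x') \<in> r \<longleftrightarrow> (y, y') \<in> s"
    using f unfolding partial_iso_def by fast+
  have "finite X" "finite Y"
    using finite_Range[OF fin] by (auto simp: X_def Y_def elim!: finite_subset[rotated])
  moreover have "X \<subseteq> B" "Y \<subseteq> B" using sub by (auto simp: X_def Y_def)
  moreover have "(x, y) \<in> s" if "x \<in> X" "y \<in> Y" for x y
    using that iso A(1) unfolding X_def Y_def by (blast dest: transD)
  ultimately obtain b where b: "b \<in> B" "\<And>x. x \<in> X \<Longrightarrow> (x, b) \<in> s" "\<And>y. y \<in> Y \<Longrightarrow> (b, y) \<in> s"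
    using dense_unbounded_between[OF B] by metis
  have s: "trans s" "irrefl s" using B by (simp_all add: dense_unbounded_def)
  have *: "x \<noteq> a \<and> y \<noteq> b \<and> ((x, a) \<in> r \<longleftrightarrow> (y, b) \<in> s) \<and> ((a, x) \<in> r \<longleftrightarrow> (b, y) \<in> s)"
    if xy: "(x, y) \<in> f" for x y
  proof -
    have x: "x \<noteq> a" "x \<in> A" using xy False sub by auto
    have ir: "(z, z) \<notin> r" "(w, w) \<notin> s" for z w using A(2) s(2) by (auto simp: irrefl_def)
    consider "(x, a) \<in> r" | "(a, x) \<in> r" using x a A(3) unfolding total_on_def by blast
    then show ?thesis
    proof cases
      case 1
      then have "(y, b) \<in> s" using b(2) xy unfolding X_def by blast
      moreover from 1 have "(a, x) \<notin> r" using A(1) ir by (meson transE)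
      moreover from \<open>(y, b) \<in> s\<close> have "(b, y) \<notin> s" "y \<noteq> b" using s(1) ir by (meson transE)+
      ultimately show ?thesis using 1 x by blast
    next
      case 2
      then have "(b, y) \<in> s" using b(3) xy unfolding Y_def by blast
      moreover from 2 have "(x, a) \<notin> r" using A(1) ir by (meson transE)
      moreover from \<open>(b, y) \<in> s\<close> have "(y, b) \<notin> s" "y \<noteq> b" using s(1) ir by (meson transE)+
      ultimately show ?thesis using 2 x by blast
    qed
  qed
  have "(a, a) \<notin> r" "(b, b) \<notin> s" using A(2) s(2) by (auto simp: irrefl_def)
  then have "partial_iso A r B s (insert (a, b) f)"
    using f a b(1) * unfolding partial_iso_def by auto
  then show ?thesis using b(1) by blast
qed

theorem cantor_order_iso:
  assumes A: "dense_unbounded A r" "countable A" and B: "dense_unbounded B s" "countable B"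
  shows "\<exists>f. order_iso f A r B s"
proof -
  have ord: "trans r" "irrefl r" "total_on A r" "trans s" "irrefl s" "total_on B s"
    and ne: "A \<noteq> {}" "B \<noteq> {}"
    using A B by (simp_all add: dense_unbounded_def)
  define a where "a = from_nat_into A"
  define b where "b = from_nat_into B"
  have a: "range a = A" and b: "range b = B"
    unfolding a_def b_def using A B ne by (simp_all add: range_from_nat_into)
  have "\<exists>g. partial_iso A r B s g \<and> f \<subseteq> g \<and> a n \<in> Domain g \<and> b n \<in> Range g"
    if f: "partial_iso A r B s f" for f n
  proof -
    have an: "a n \<in> A" and bn: "b n \<in> B" using a b by auto
    from partial_iso_extend[OF ord(1-3) B(1) f an]
    obtain y where y: "partial_iso A r B s (insert (a n, y) f)" by blast
    from partial_iso_extend[OF ord(4-6) A(1) partial_iso_converse[OF y] bn]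
    obtain x where "partial_iso B s A r (insert (b n, x) ((insert (a n, y) f)\<inverse>))" by blast
    then have "partial_iso A r B s ((insert (b n, x) ((insert (a n, y) f)\<inverse>))\<inverse>)"
      by (rule partial_iso_converse)
    also have "(insert (b n, x) ((insert (a n, y) f)\<inverse>))\<inverse> = insert (x, b n) (insert (a n, y) f)"
      by auto
    finally show ?thesis
      by (intro exI[of _ "insert (x, b n) (insert (a n, y) f)"]) auto
  qed
  then have step: "\<exists>g. partial_iso A r B s g \<and> (f \<subseteq> g \<and> a n \<in> Domain g \<and> b n \<in> Range g)"
    if "partial_iso A r B s f" for f n using that by blast
  have "partial_iso A r B s {}" by (simp add: partial_iso_def)
  then have "\<exists>F. \<forall>n. partial_iso A r B s (F n) \<and>
      (F n \<subseteq> F (Suc n) \<and> a n \<in> Domain (F (Suc n)) \<and> b n \<in> Range (F (Suc n)))"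
    using step by (intro dependent_nat_choice) blast+
  then obtain F where F: "\<And>n. partial_iso A r B s (F n)" "\<And>n. F n \<subseteq> F (Suc n)"
    "\<And>n. a n \<in> Domain (F (Suc n))" "\<And>n. b n \<in> Range (F (Suc n))" by blast
  have mono: "F m \<subseteq> F n" if "m \<le> n" for m n using F(2) that by (rule lift_Suc_mono_le)
  define G where "G = (\<Union>n. F n)"
  \<comment> \<open>The stages form a chain, so any two pairs of the union already lie in one common
    stage.\<close>
  have G: "x \<in> A" "y \<in> B" "x = x' \<longleftrightarrow> y = y'" "(x, x') \<in> r \<longleftrightarrow> (y, y') \<in> s"
    if xy: "(x, y) \<in> G" "(x', y') \<in> G" for x y x' y'
  proof -
    from xy obtain m n where "(x, y) \<in> F m" "(x', y') \<in> F n" by (auto simp: G_def)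
    then have "(x, y) \<in> F (max m n)" "(x', y') \<in> F (max m n)"
      using mono[of m "max m n"] mono[of n "max m n"] by auto
    then show "x \<in> A" "y \<in> B" "x = x' \<longleftrightarrow> y = y'" "(x, x') \<in> r \<longleftrightarrow> (y, y') \<in> s"
      using F(1)[of "max m n"] unfolding partial_iso_def by fast+
  qed
  have dom: "\<exists>y. (x, y) \<in> G" if "x \<in> A" for x
    using that F(3) unfolding a[symmetric] G_def by blast
  have ran: "\<exists>x. (x, y) \<in> G" if "y \<in> B" for y
    using that F(4) unfolding b[symmetric] G_def by blast
  define f where "f = (\<lambda>x. SOME y. (x, y) \<in> G)"
  have f: "(x, f x) \<in> G" if "x \<in> A" for x
    unfolding f_def using dom[OF that] by (rule someI_ex)
  have "order_iso f A r B s"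
    unfolding order_iso_def
  proof (intro conjI ballI bij_betw_imageI inj_onI equalityI subsetI)
    fix x x' assume x: "x \<in> A" "x' \<in> A"
    show "(x, x') \<in> r \<longleftrightarrow> (f x, f x') \<in> s" using G(4)[OF f f] x by blast
    show "x = x'" if "f x = f x'" using G(3)[OF f f] x that by blast
  next
    fix y assume "y \<in> f ` A"
    then show "y \<in> B" using G(2) f by blast
  next
    fix y assume "y \<in> B"
    then obtain x where "(x, y) \<in> G" using ran by blast
    then have "x \<in> A" "f x = y" using G(1,3) f by metis+
    then show "y \<in> f ` A" by blast
  qed
  then show ?thesis by blast
qed

lemma dense_unbounded_rat: "dense_unbounded (UNIV :: rat set) less_rel"
  unfolding dense_unbounded_def less_rel_def
  by (auto simp: trans_def irrefl_def total_on_def intro: dense gt_ex lt_ex)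

text \<open>With \<open>T\<close> total, a monotone \<open>F\<close> must be injective and reflect
  the order, since otherwise some \<open>F u\<close> would lie below itself. The inverse of
  \<open>F\<close> is the isomorphism.\<close>

lemma same_order_type_if_enumeration:
  assumes "total T" "trans r" "irrefl r" "range F = A"
    and mono: "\<And>u v. (u, v) \<in> T \<Longrightarrow> (F u, F v) \<in> r"
  shows "same_order_type A r UNIV T"
proof -
  have iff: "(F u, F v) \<in> r \<longleftrightarrow> (u, v) \<in> T" for u v
  proof
    assume *: "(F u, F v) \<in> r"
    show "(u, v) \<in> T"
    proof (rule ccontr)
      assume "(u, v) \<notin> T"
      then have "u = v \<or> (v, u) \<in> T" using assms(1) unfolding total_on_def by blast
      then have "(F u, F u) \<in> r" using * mono transD[OF assms(2)] by blast
      then show False using assms(3) by (simp add: irrefl_def)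
    qed
  qed (rule mono)
  have "inj F"
  proof (rule injI, rule ccontr)
    fix u v assume "F u = F v" "u \<noteq> v"
    then have "(F u, F u) \<in> r" using assms(1) mono unfolding total_on_def by (metis UNIV_I)
    then show False using assms(3) by (simp add: irrefl_def)
  qed
  then have "bij_betw F UNIV A" using assms(4) by (simp add: bij_betw_def)
  then have "bij_betw (inv F) A UNIV" by (rule bij_betw_inv_into)
  moreover have "F (inv F x) = x" if "x \<in> A" for x
    using that assms(4) by (simp add: f_inv_into_f)
  ultimately have "order_iso (inv F) A r UNIV T"
    unfolding order_iso_def using iff by metis
  then show ?thesis unfolding same_order_type_def by blast
qed

lemma total_omega_plus_zeta_eta: "total omega_plus_zeta_eta"
proof (rule total_onI)
  fix u v :: "nat + rat \<times> int" assume "u \<noteq> v"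
  then show "(u, v) \<in> omega_plus_zeta_eta \<or> (v, u) \<in> omega_plus_zeta_eta"
    by (cases u; cases v) (auto simp: omega_plus_zeta_eta_def order_sum_def less_rel_def)
qed

text \<open>The ranks are forgotten here. These axioms already force the blocks of points at finite
  distance to look like \<omega>, for the block of \<open>least\<close>, or like \<zeta>, for all
  others; how the blocks are arranged is left to the final result.\<close>

locale discrete_order =
  fixes A :: "'a set" and r :: "'a rel" and s :: "'a \<Rightarrow> 'a" and least :: 'a
  assumes trans: "trans r" and irrefl: "irrefl r" and total: "total_on A r"
    and succ: "x \<in> A \<Longrightarrow> s x \<in> A" "x \<in> A \<Longrightarrow> (x, s x) \<in> r"
    and succ_le: "x \<in> A \<Longrightarrow> y \<in> A \<Longrightarrow> (x, y) \<in> r \<Longrightarrow> s x = y \<or> (s x, y) \<in> r"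
    and least: "least \<in> A" "x \<in> A \<Longrightarrow> (x, least) \<notin> r"
    and pred: "x \<in> A \<Longrightarrow> x \<noteq> least \<Longrightarrow> \<exists>y\<in>A. s y = x"
begin

lemma not_less_self: "(x, x) \<notin> r"
  using irrefl by (simp add: irrefl_def)

lemma less_trans: "(x, y) \<in> r \<Longrightarrow> (y, z) \<in> r \<Longrightarrow> (x, z) \<in> r"
  using trans by (rule transD)

lemma less_linear: "x \<in> A \<Longrightarrow> y \<in> A \<Longrightarrow> x = y \<or> (x, y) \<in> r \<or> (y, x) \<in> r"
  using total unfolding total_on_def by blast

lemma succ_mono: "x \<in> A \<Longrightarrow> y \<in> A \<Longrightarrow> (x, y) \<in> r \<Longrightarrow> (s x, s y) \<in> r"
  using succ_le[of x y] succ(2)[of y] less_trans by metis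

lemma succ_less_iff: "x \<in> A \<Longrightarrow> y \<in> A \<Longrightarrow> (s x, s y) \<in> r \<longleftrightarrow> (x, y) \<in> r"
  using succ_mono less_linear less_trans not_less_self by metis

lemma pow_in: "x \<in> A \<Longrightarrow> (s ^^ n) x \<in> A"
  by (induction n) (auto simp: succ)

lemma pow_less_iff: "x \<in> A \<Longrightarrow> y \<in> A \<Longrightarrow> ((s ^^ n) x, (s ^^ n) y) \<in> r \<longleftrightarrow> (x, y) \<in> r"
  by (induction n) (auto simp: succ_less_iff pow_in)

lemma pow_inj: "x \<in> A \<Longrightarrow> y \<in> A \<Longrightarrow> (s ^^ n) x = (s ^^ n) y \<Longrightarrow> x = y"
  using less_linear[of x y] pow_less_iff[of x y n] pow_less_iff[of y x n] not_less_self by metis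

lemma pow_strict_mono: "x \<in> A \<Longrightarrow> m < n \<Longrightarrow> ((s ^^ m) x, (s ^^ n) x) \<in> r"
proof (induction n)
  case (Suc n)
  then have "((s ^^ n) x, (s ^^ Suc n) x) \<in> r" by (simp add: succ(2) pow_in)
  then show ?case using Suc less_trans by (metis less_Suc_eq)
qed simp

section \<open>Points at finite and at infinite distance\<close>

definition far :: "'a \<Rightarrow> 'a \<Rightarrow> bool" where
  "far x y \<longleftrightarrow> (\<forall>n. ((s ^^ n) x, y) \<in> r)"

text \<open>A common iterate, in place of one point being an iterate of the other, makes the
  relation symmetric at once.\<close>

definition near :: "'a \<Rightarrow> 'a \<Rightarrow> bool" where
  "near x y \<longleftrightarrow> (\<exists>m n. (s ^^ m) x = (s ^^ n) y)"

lemma far_less: "far x y \<Longrightarrow> (x, y) \<in> r"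
  unfolding far_def by (metis funpow_0)

lemma far_succ_left: assumes "x \<in> A" shows "far (s x) y \<longleftrightarrow> far x y"
proof -
  have "((s ^^ n) x, (s ^^ n) (s x)) \<in> r" for n
    using pow_strict_mono[OF assms, of n "Suc n"] by (simp add: funpow_swap1)
  moreover have "(s ^^ n) (s x) = (s ^^ Suc n) x" for n by (simp add: funpow_swap1)
  ultimately show ?thesis unfolding far_def using less_trans by metis
qed

lemma far_succ_right: assumes "x \<in> A" "y \<in> A" shows "far x (s y) \<longleftrightarrow> far x y"
proof
  assume *: "far x (s y)"
  show "far x y"
    unfolding far_def
  proof
    fix n
    have "(s ((s ^^ n) x), s y) \<in> r" using * unfolding far_def by (metis funpow.simps(2) comp_apply)
    then show "((s ^^ n) x, y) \<in> r" using assms by (simp add: succ_less_iff pow_in)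
  qed
next
  assume "far x y"
  then show "far x (s y)" unfolding far_def using succ(2)[OF assms(2)] less_trans by blast
qed

lemma far_pow_iff: "x \<in> A \<Longrightarrow> y \<in> A \<Longrightarrow> far ((s ^^ m) x) ((s ^^ n) y) \<longleftrightarrow> far x y"
proof -
  assume xy: "x \<in> A" "y \<in> A"
  have "far ((s ^^ m) x) z \<longleftrightarrow> far x z" for z
    by (induction m) (auto simp: far_succ_left pow_in xy)
  moreover have "far x ((s ^^ n) y) \<longleftrightarrow> far x y"
    by (induction n) (auto simp: far_succ_right pow_in xy)
  ultimately show ?thesis by blast
qed

lemma near_refl: "near x x"
  unfolding near_def by blast

lemma near_sym: "near x y \<Longrightarrow> near y x"
  unfolding near_def by metis

lemma near_trans: assumes "near x y" "near y z" shows "near x z"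
proof -
  obtain a b c d where 1: "(s ^^ a) x = (s ^^ b) y" and 2: "(s ^^ c) y = (s ^^ d) z"
    using assms unfolding near_def by blast
  have "(s ^^ (c + a)) x = (s ^^ (b + c)) y" by (simp add: funpow_add 1 flip: add.commute[of c])
  also have "\<dots> = (s ^^ (b + d)) z" by (simp add: funpow_add 2)
  finally show ?thesis unfolding near_def by blast
qed

lemma far_near_cong:
  assumes "x \<in> A" "x' \<in> A" "y \<in> A" "y' \<in> A" "near x x'" "near y y'" "far x y"
  shows "far x' y'"
proof -
  obtain a b c d where "(s ^^ a) x = (s ^^ b) x'" "(s ^^ c) y = (s ^^ d) y'"
    using assms unfolding near_def by blast
  then show ?thesis using assms far_pow_iff[of x y a c] far_pow_iff[of x' y' b d] by simp
qed

text \<open>Iterates of \<open>x\<close> cannot jump over \<open>y\<close>: by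
  \<open>succ_le\<close> they would have to hit it first, and then \<open>x\<close> and
  \<open>y\<close> would be near.\<close>

lemma less_imp_near_or_far:
  assumes "x \<in> A" "y \<in> A" "(x, y) \<in> r" "\<not> near x y"
  shows "far x y"
  unfolding far_def
proof
  fix n
  have ne: "(s ^^ n) x \<noteq> y" for n using assms(4) unfolding near_def by (metis funpow_0)
  show "((s ^^ n) x, y) \<in> r"
  proof (induction n)
    case (Suc n)
    then show ?case using succ_le[OF pow_in assms(2) Suc] assms(1) ne[of "Suc n"] by simp
  qed (use assms in simp)
qed

lemma near_far_cases: "x \<in> A \<Longrightarrow> y \<in> A \<Longrightarrow> near x y \<or> far x y \<or> far y x"
  using less_linear[of x y] less_imp_near_or_far[of x y] less_imp_near_or_far[of y x]
    near_refl[of x] near_sym[of y x] by blast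

text \<open>The points outside the first block.\<close>

definition B :: "'a set" where "B = {x \<in> A. far least x}"

lemma B_near: "x \<in> B \<Longrightarrow> y \<in> A \<Longrightarrow> near x y \<Longrightarrow> y \<in> B"
  unfolding B_def using far_near_cong[of least least x y] near_refl least(1) by blast

text \<open>Stepping down stays near \<open>x\<close> and hence in \<open>B\<close>, so
  \<open>least\<close> is never met and a further predecessor exists.\<close>

lemma B_pow_pred: "x \<in> B \<Longrightarrow> \<exists>y\<in>A. (s ^^ n) y = x"
proof (induction n)
  case (Suc n)
  then obtain y where y: "y \<in> A" "(s ^^ n) y = x" by blast
  then have "near x y" unfolding near_def by (metis funpow_0)
  then have "far least y" using B_near Suc.prems y unfolding B_def by blast
  then have "y \<noteq> least" using far_less not_less_self by blast
  then obtain z where "z \<in> A" "s z = y" using pred y by blast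
  then show ?case using y by (intro bexI[of _ z]) (simp_all add: funpow_swap1)
qed (auto simp: B_def)

definition shift :: "'a \<Rightarrow> int \<Rightarrow> 'a" where
  "shift x i = (if 0 \<le> i then (s ^^ nat i) x else (SOME y. y \<in> A \<and> (s ^^ nat (- i)) y = x))"

lemma shift_neg: assumes "x \<in> B" "i < 0" shows "shift x i \<in> A" "(s ^^ nat (- i)) (shift x i) = x"
  using someI_ex[OF B_pow_pred[OF assms(1), of "nat (- i)", unfolded Bex_def]] assms(2)
  by (simp_all add: shift_def)

lemma shift_in: "x \<in> B \<Longrightarrow> shift x i \<in> A"
  using shift_neg(1)[of x i] pow_in[of x "nat i"] by (cases "0 \<le> i") (auto simp: shift_def B_def)

text \<open>Enough further successor steps turn an integer shift into a natural iterate. Shifts are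
  compared by first raising both of them in this way.\<close>

lemma pow_shift:
  assumes "x \<in> B" "0 \<le> i + int m"
  shows "(s ^^ m) (shift x i) = (s ^^ nat (i + int m)) x"
proof (cases "0 \<le> i")
  case True
  then have "nat (i + int m) = m + nat i" by simp
  with True show ?thesis by (simp add: shift_def funpow_add)
next
  case False
  then have m: "m = nat (i + int m) + nat (- i)" using assms(2) by simp
  have "(s ^^ m) (shift x i) = (s ^^ nat (i + int m)) ((s ^^ nat (- i)) (shift x i))"
    by (subst m) (simp only: funpow_add comp_apply)
  then show ?thesis using shift_neg(2)[OF assms(1), of i] False by simp
qed

lemma near_shift: "x \<in> B \<Longrightarrow> near x (shift x i)"
  using pow_shift[of x i "nat (- i)"] unfolding near_def by (metis int_nat_eq linear neg_le_0_iff_le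
      add.right_inverse add.right_neutral order_refl)

lemma shift_strict_mono:
  assumes "x \<in> B" "i < j"
  shows "(shift x i, shift x j) \<in> r"
proof -
  \<comment> \<open>Raising by \<open>- i\<close>, if \<open>i\<close> is negative, makes the
    smaller index nonnegative and with it the larger one.\<close>
  define m where "m = nat (- i)"
  have "0 \<le> i + int m" "0 \<le> j + int m" "nat (i + int m) < nat (j + int m)"
    using assms(2) by (auto simp: m_def)
  then have "((s ^^ m) (shift x i), (s ^^ m) (shift x j)) \<in> r"
    using assms(1) by (simp add: pow_shift pow_strict_mono B_def)
  then show ?thesis using pow_less_iff[OF shift_in shift_in] assms(1) by blast
qed

lemma near_imp_shift:
  assumes "x \<in> B" "y \<in> A" "near x y"
  shows "\<exists>i. y = shift x i"
proof -
  obtain m n where mn: "(s ^^ m) x = (s ^^ n) y" using assms(3) unfolding near_def by blast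
  have "(s ^^ n) (shift x (int m - int n)) = (s ^^ n) y"
    using pow_shift[OF assms(1), of "int m - int n" n] mn by simp
  then have "shift x (int m - int n) = y"
    by (rule pow_inj[OF shift_in[OF assms(1)] assms(2)])
  then show ?thesis by blast
qed

text \<open>The choice depends only on the block of \<open>x\<close>, because near points have the
  same near points; so \<open>rep\<close> picks one point from each block inside
  \<open>B\<close>.\<close>

definition rep :: "'a \<Rightarrow> 'a" where "rep x = (SOME y. y \<in> B \<and> near x y)"

lemma rep: assumes "x \<in> B" shows "rep x \<in> B" "near x (rep x)"
  using someI[of "\<lambda>y. y \<in> B \<and> near x y" x] assms near_refl by (simp_all add: rep_def)

lemma rep_cong: assumes "near x y" shows "rep x = rep y"
proof -
  have "near x z \<longleftrightarrow> near y z" for z using assms near_sym near_trans by blast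
  then show ?thesis by (simp add: rep_def)
qed

lemma near_rep_eq:
  assumes "x \<in> rep ` B" "y \<in> rep ` B" "near x y"
  shows "x = y"
proof -
  obtain a b where ab: "a \<in> B" "b \<in> B" "x = rep a" "y = rep b" using assms by blast
  then have "near a b" using assms(3) rep[of a] rep[of b] near_trans near_sym by metis
  then show ?thesis using ab rep_cong by blast
qed

lemma rep_less_iff_far: "x \<in> rep ` B \<Longrightarrow> y \<in> rep ` B \<Longrightarrow> (x, y) \<in> r \<longleftrightarrow> far x y"
proof -
  assume x: "x \<in> rep ` B" and y: "y \<in> rep ` B"
  then have "x \<in> A" "y \<in> A" using rep(1) by (auto simp: B_def)
  then show ?thesis
    using near_rep_eq[OF x y] less_imp_near_or_far[of x y] far_less[of x y] not_less_self by metis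
qed

text \<open>The representatives of the blocks outside the first form a countable dense order without
  endpoints, hence a copy of the rationals. Iterates of \<open>least\<close> enumerate the first
  block, and shifts of the representative \<open>h q\<close> enumerate the block at
  \<open>q\<close>.\<close>

lemma same_order_type_omega_plus_zeta_eta:
  assumes count: "countable A"
    and dense: "\<And>x y. x \<in> A \<Longrightarrow> y \<in> A \<Longrightarrow> far x y \<Longrightarrow> \<exists>z\<in>A. far x z \<and> far z y"
    and unbounded: "\<And>x. x \<in> A \<Longrightarrow> \<exists>y\<in>A. far x y"
  shows "same_order_type A r UNIV omega_plus_zeta_eta"
proof -
  have BA: "B \<subseteq> A" by (auto simp: B_def)
  have above: "y \<in> B" if "far x y" "x \<in> A" "y \<in> A" for x y
  proof -
    have "least = x \<or> (least, x) \<in> r" using less_linear least that by blast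
    then have "((s ^^ n) least, y) \<in> r" for n
      using that(1) pow_less_iff[OF least(1) that(2), of n] less_trans unfolding far_def by metis
    then show ?thesis using that(3) by (simp add: B_def far_def)
  qed
  have rep_far: "far (rep x) y \<longleftrightarrow> far x y" "far y (rep x) \<longleftrightarrow> far y x" if "x \<in> B" "y \<in> A" for x y
    using that rep[OF that(1)] BA far_near_cong near_refl near_sym by (meson subsetD)+
  have "dense_unbounded (rep ` B) r"
    unfolding dense_unbounded_def
  proof (intro conjI ballI impI trans irrefl)
    obtain y where "y \<in> A" "far least y" using unbounded least by blast
    then show "rep ` B \<noteq> {}" by (auto simp: B_def)
    show "total_on (rep ` B) r" using total rep(1) BA by (auto simp: total_on_def)
  next
    fix x assume x: "x \<in> rep ` B"
    then have xB: "x \<in> B" and xA: "x \<in> A" using rep(1) BA by auto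
    \<comment> \<open>There is no first block in \<open>B\<close>, by density between
      \<open>least\<close> and \<open>x\<close>; that there is no last one comes from
      \<open>unbounded\<close>.\<close>
    obtain y where y: "y \<in> A" "far least y" "far y x"
      using dense[OF least(1) xA] xB by (auto simp: B_def)
    then have "y \<in> B" by (simp add: B_def)
    then show "\<exists>y\<in>rep ` B. (y, x) \<in> r"
      using rep_far(1)[of y x] y xA by (intro bexI[of _ "rep y"]) (auto intro: far_less)
    obtain y where y: "y \<in> A" "far x y" using unbounded xA by blast
    then have "y \<in> B" using above xA by blast
    then show "\<exists>y\<in>rep ` B. (x, y) \<in> r"
      using rep_far(2)[of y x] y xA by (intro bexI[of _ "rep y"]) (auto intro: far_less)
  next
    fix x y assume xy: "x \<in> rep ` B" "y \<in> rep ` B" "(x, y) \<in> r"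
    then have A: "x \<in> A" "y \<in> A" using rep(1) BA by auto
    obtain z where z: "z \<in> A" "far x z" "far z y"
      using dense[OF A] rep_less_iff_far xy by blast
    then have "z \<in> B" using above A by blast
    then show "\<exists>z\<in>rep ` B. (x, z) \<in> r \<and> (z, y) \<in> r"
      using rep_far[of z x] rep_far[of z y] z A
      by (intro bexI[of _ "rep z"]) (auto intro: far_less)
  qed
  moreover have "countable (rep ` B)" using count BA by (auto intro: countable_subset)
  ultimately obtain h where "order_iso h (UNIV :: rat set) less_rel (rep ` B) r"
    using cantor_order_iso[OF dense_unbounded_rat] by (metis uncountable_def countableI_type)
  then have h: "range h = rep ` B" "\<And>p q. p < q \<Longrightarrow> (h p, h q) \<in> r"
    by (auto simp: order_iso_def bij_betw_def less_rel_def)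
  have hrep: "h q \<in> rep ` B" for q using h(1) by blast
  have hB: "h q \<in> B" "h q \<in> A" for q using hrep[of q] rep(1) BA by auto
  define F where "F = case_sum (\<lambda>n. (s ^^ n) least) (\<lambda>(q, i). shift (h q) i)"
  show ?thesis
  proof (rule same_order_type_if_enumeration[OF total_omega_plus_zeta_eta trans irrefl])
    fix u v assume "(u, v) \<in> omega_plus_zeta_eta"
    then consider m n where "u = Inl m" "v = Inl n" "m < n"
      | m q i where "u = Inl m" "v = Inr (q, i)"
      | p q i j where "u = Inr (p, i)" "v = Inr (q, j)" "p < q"
      | q i j where "u = Inr (q, i)" "v = Inr (q, j)" "i < j"
      by (auto simp: omega_plus_zeta_eta_def order_sum_def less_rel_def)
    then show "(F u, F v) \<in> r"
    proof cases
      case 1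
      then show ?thesis by (simp add: F_def pow_strict_mono least)
    next
      case (2 m q i)
      have "far least (shift (h q) i)"
        using B_near[OF hB(1) shift_in near_shift] hB(1) by (simp add: B_def)
      then show ?thesis by (simp add: 2 F_def far_def)
    next
      case (3 p q i j)
      have "far (h p) (h q)" using h(2)[OF 3(3)] rep_less_iff_far[OF hrep hrep] by blast
      then have "far (shift (h p) i) (shift (h q) j)"
        using far_near_cong[OF hB(2) shift_in[OF hB(1)] hB(2) shift_in[OF hB(1)]
            near_shift[OF hB(1)] near_shift[OF hB(1)]] by blast
      then show ?thesis by (simp add: 3 F_def far_less)
    next
      case (4 q i j)
      then show ?thesis by (simp add: F_def shift_strict_mono hB)
    qed
  next
    show "range F = A"
    proof (intro equalityI subsetI)
      fix x assume "x \<in> range F"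
      then obtain u where "x = F u" by blast
      then show "x \<in> A" by (cases u) (auto simp: F_def pow_in least shift_in hB)
    next
      fix x assume x: "x \<in> A"
      show "x \<in> range F"
      proof (cases "near least x")
        case True
        then obtain m n where mn: "(s ^^ m) least = (s ^^ n) x" unfolding near_def by blast
        \<comment> \<open>Otherwise \<open>least\<close> would be a proper iterate of
          \<open>x\<close> and so lie above \<open>x\<close>.\<close>
        have "n \<le> m"
        proof (rule ccontr)
          assume "\<not> n \<le> m"
          then have "(s ^^ n) x = (s ^^ m) ((s ^^ (n - m)) x)"
            by (metis funpow_add comp_apply le_add_diff_inverse linear)
          then have "least = (s ^^ (n - m)) x"
            using mn pow_inj least(1) pow_in x by metis
          moreover have "(x, (s ^^ (n - m)) x) \<in> r"
            using pow_strict_mono[OF x, of 0 "n - m"] \<open>\<not> n \<le> m\<close> by simp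
          ultimately show False using least(2) x by metis
        qed
        then have "(s ^^ n) ((s ^^ (m - n)) least) = (s ^^ n) x"
          using mn by (metis funpow_add comp_apply le_add_diff_inverse)
        then have "(s ^^ (m - n)) least = x" using pow_inj pow_in least(1) x by metis
        then have "x = F (Inl (m - n))" by (simp add: F_def)
        then show ?thesis by blast
      next
        case False
        moreover have "\<not> far x least" using far_less least(2) x by blast
        ultimately have "far least x" using near_far_cases[OF least(1) x] by blast
        then have xB: "x \<in> B" using x by (simp add: B_def)
        then obtain q where q: "rep x = h q" using h(1) by (metis imageI image_iff)
        obtain i where "x = shift (h q) i"
          using near_imp_shift[OF rep(1)[OF xB] x near_sym[OF rep(2)[OF xB]]] q by auto
        then have "x = F (Inr (q, i))" by (simp add: F_def)
        then show ?thesis by blast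
      qed
    qed
  qed
qed

end

section \<open>Partial computable functions\<close>

lemma partial_computable_total: "computable_fun f \<Longrightarrow> partial_computable (\<lambda>x. Some (f x))"
  unfolding partial_computable_def computable_fun_iff by metis

lemma partial_computable_bind:
  assumes "partial_computable \<phi>" "partial_computable \<psi>"
  shows "partial_computable (\<lambda>x. Option.bind (\<phi> x) \<psi>)"
proof -
  obtain p q where pq: "\<And>x. \<phi> x = eval p [x]" "\<And>x. \<psi> x = eval q [x]"
    using assms unfolding partial_computable_def by blast
  have "Option.bind (\<phi> x) \<psi> = eval (Comp q [p]) [x]" for x
    by (cases "\<phi> x") (simp_all add: pq[symmetric])
  then show ?thesis unfolding partial_computable_def by blast
qed

lemma partial_computable_map:
  assumes "partial_computable \<phi>" "computable_fun f"
  shows "partial_computable (\<lambda>x. map_option f (\<phi> x))"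
proof -
  have "map_option f (\<phi> x) = Option.bind (\<phi> x) (\<lambda>a. Some (f a))" for x
    by (cases "\<phi> x") simp_all
  then show ?thesis
    using partial_computable_bind[OF assms(1) partial_computable_total[OF assms(2)]] by simp
qed

lemma partial_computable_pair:
  assumes "partial_computable \<phi>" "partial_computable \<psi>"
  shows "partial_computable (\<lambda>x. Option.bind (\<phi> x) (\<lambda>a. map_option (\<lambda>b. prod_encode (a, b)) (\<psi> x)))"
proof -
  obtain p q where pq: "\<And>x. \<phi> x = eval p [x]" "\<And>x. \<psi> x = eval q [x]"
    using assms unfolding partial_computable_def by blast
  obtain c where c: "\<And>x y. eval c [x, y] = Some (prod_encode (x, y))"
    using computable_fun2_prod_encode unfolding computable_fun2_iff by blast
  have "Option.bind (\<phi> x) (\<lambda>a. map_option (\<lambda>b. prod_encode (a, b)) (\<psi> x)) = eval (Comp c [p, q]) [x]" for x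
    by (cases "\<phi> x"; cases "\<psi> x") (simp_all add: pq[symmetric] c)
  then show ?thesis unfolding partial_computable_def by blast
qed

lemma partial_computable_search:
  assumes "computable_fun (\<lambda>z. of_bool (P (pfst z) (psnd z)))"
  shows "partial_computable (\<lambda>x. if \<exists>y. P x y then Some (LEAST y. P x y) else None)"
proof -
  \<comment> \<open>\<open>Mu\<close> puts the searched variable first and looks for the value 0,
    hence the exchanged arguments and the negated predicate.\<close>
  have "computable_fun (\<lambda>z. prod_encode (psnd z, pfst z))" by (intro comp_fun)
  from computable_fun_comp[OF assms this]
  have "computable_fun (\<lambda>z. of_bool (P (psnd z) (pfst z)))" by simp
  then have "computable_fun (\<lambda>z. of_bool (\<not> P (psnd z) (pfst z)))"
    by (rule computable_pred_intros(3))
  then obtain p where "\<And>y x. eval p [y, x] = Some (of_bool (\<not> P x y))"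
    using computable_fun2_uncurry[of "\<lambda>y x. of_bool (\<not> P x y)"] unfolding computable_fun2_iff by blast
  then have "(if \<exists>y. P x y then Some (LEAST y. P x y) else None) = eval (Mu p) [x]" for x
    by simp
  then show ?thesis unfolding partial_computable_def by blast
qed

instance recf :: countable
  by countable_datatype

lemma countable_partial_computable: "countable (Collect partial_computable)"
proof -
  have "Collect partial_computable \<subseteq> range (\<lambda>p x. eval p [x])"
    by (auto simp: partial_computable_def image_iff fun_eq_iff)
  then show ?thesis by (rule countable_subset) simp
qed

section \<open>Orders ranked by natural numbers\<close>

text \<open>
  The rank embeds the order into \<open>\<nat>\<close>. Its range is a c.e. set containing all even numbers, which
  need not be computable: this is where the noncomputability of the isomorphism with \<open>\<nat>\<close> hides.
\<close>

locale ranked_order =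
  fixes L :: "nat set" and \<rho> :: "nat \<Rightarrow> nat"
  assumes computable_carrier: "computable_fun (\<lambda>x. of_bool (x \<in> L))"
    and computable_rank: "computable_fun \<rho>"
    and inj_rank: "inj_on \<rho> L"
    and even_rank: "2 * n \<in> \<rho> ` L"
begin

definition rank_less :: "nat rel" where
  "rank_less = {(x, y). x \<in> L \<and> y \<in> L \<and> \<rho> x < \<rho> y}"

lemma rank_less_props: "trans rank_less" "irrefl rank_less" "total_on L rank_less"
  using inj_rank
  by (auto simp: rank_less_def trans_def irrefl_def total_on_def inj_on_def)
    (metis linorder_neqE_nat)

lemma computable_linear_order_rank: "computable_linear_order L rank_less"
proof -
  have "computable_fun (\<lambda>z. of_bool ((pfst z, psnd z) \<in> rank_less))"
    unfolding rank_less_def mem_Collect_eq prod.case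
    by (intro comp_fun computable_fun_comp[OF computable_rank] computable_fun_comp[OF computable_carrier])
  then have "computable_rel rank_less"
    using computable_fun2_uncurry[of "\<lambda>x y. of_bool ((x, y) \<in> rank_less)"]
    by (simp add: computable_fun2_iff computable_rel_def)
  moreover have "computable_set L"
    using computable_carrier by (simp add: computable_set_def computable_fun_iff)
  ultimately show ?thesis
    using rank_less_props
    by (auto simp: computable_linear_order_def strict_linear_order_on_def rank_less_def)
qed

lemma infinite_rank: "infinite (\<rho> ` L)"
proof -
  have "infinite (range (\<lambda>n :: nat. 2 * n))" by (rule range_inj_infinite) (simp add: inj_def)
  then show ?thesis using even_rank by (metis finite_subset image_subsetI)
qed

lemma same_order_type_rank: "same_order_type L rank_less (UNIV :: nat set) less_rel"
proof (rule same_order_type_if_enumeration)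
  let ?F = "\<lambda>n. inv_into L \<rho> (enumerate (\<rho> ` L) n)"
  have F: "?F n \<in> L" "\<rho> (?F n) = enumerate (\<rho> ` L) n" for n
    using enumerate_in_set[OF infinite_rank] by (auto intro: inv_into_into f_inv_into_f)
  show "range ?F = L"
  proof (intro equalityI subsetI)
    fix x assume "x \<in> L"
    then obtain n where "enumerate (\<rho> ` L) n = \<rho> x"
      using enumerate_Ex[OF infinite_rank] by (metis imageI)
    then have "?F n = x" using \<open>x \<in> L\<close> inj_rank by simp
    then show "x \<in> range ?F" by blast
  qed (use F in blast)
  show "(?F m, ?F n) \<in> rank_less" if "(m, n) \<in> less_rel" for m n
    using that F infinite_rank by (simp add: rank_less_def less_rel_def)
qed (use rank_less_props in \<open>auto simp: less_rel_def total_on_def\<close>)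

text \<open>
  An isomorphism with \<open>\<nat>\<close> detects whether the elements of ranks \<open>2 * n\<close> and \<open>2 * n + 2\<close> are adjacent.
\<close>

lemma computable_odd_rank_if_computably_isomorphic:
  assumes "computably_isomorphic L rank_less (UNIV :: nat set) less_rel"
    and e: "computable_fun e" "\<And>n. e n \<in> L" "\<And>n. \<rho> (e n) = 2 * n"
  shows "computable_fun (\<lambda>n. of_bool (2 * n + 1 \<in> \<rho> ` L))"
proof -
  obtain \<phi> where \<phi>: "partial_computable \<phi>" "dom \<phi> = L"
    "order_iso (\<lambda>x. the (\<phi> x)) L rank_less (UNIV :: nat set) less_rel"
    using assms(1) unfolding computably_isomorphic_def by blast
  define f where "f = (\<lambda>x. the (\<phi> x))"
  have f: "\<And>x y. x \<in> L \<Longrightarrow> y \<in> L \<Longrightarrow> \<rho> x < \<rho> y \<longleftrightarrow> f x < f y" and surj: "\<And>m. \<exists>z\<in>L. f z = m"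
    using \<phi>(3) unfolding f_def[symmetric] order_iso_def less_rel_def rank_less_def bij_betw_def
    by (auto simp: image_iff set_eq_iff) metis
  obtain p q where p: "\<And>x. \<phi> x = eval p [x]" and q: "\<And>x. eval q [x] = Some (e x)"
    using \<phi>(1) e(1) unfolding partial_computable_def computable_fun_iff by blast
  \<comment> \<open>The isomorphism program converges only on \<open>L\<close>; after
    \<open>e\<close>, whose values lie in \<open>L\<close>, it becomes total.\<close>
  have "eval (Comp p [q]) [n] = Some (f (e n))" for n
    using e(2)[of n] \<phi>(2) by (auto simp: q p[symmetric] f_def)
  then have fe: "computable_fun (\<lambda>n. f (e n))"
    unfolding computable_fun_iff by blast
  have "2 * n + 1 \<in> \<rho> ` L \<longleftrightarrow> f (e (Suc n)) \<noteq> Suc (f (e n))" for n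
  proof
    assume "2 * n + 1 \<in> \<rho> ` L"
    then obtain z where "z \<in> L" "\<rho> z = 2 * n + 1" by fastforce
    then have "f (e n) < f z" "f z < f (e (Suc n))"
      using f[of "e n" z] f[of z "e (Suc n)"] e by auto
    then show "f (e (Suc n)) \<noteq> Suc (f (e n))" by simp
  next
    assume "f (e (Suc n)) \<noteq> Suc (f (e n))"
    moreover have "f (e n) < f (e (Suc n))" using f[of "e n" "e (Suc n)"] e by simp
    ultimately have "Suc (f (e n)) < f (e (Suc n))" by simp
    moreover obtain z where z: "z \<in> L" "f z = Suc (f (e n))" using surj by blast
    ultimately have "\<rho> (e n) < \<rho> z" "\<rho> z < \<rho> (e (Suc n))"
      using f[of "e n" z] f[of z "e (Suc n)"] e(2) by auto
    then have "\<rho> z = 2 * n + 1" using e(3) by simp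
    then show "2 * n + 1 \<in> \<rho> ` L" using z(1) by (metis imageI)
  qed
  then show ?thesis
    using fe by (simp only:) (intro comp_fun computable_fun_comp[OF fe, of Suc] computable_fun_Suc)
qed

text \<open>An unbounded search, which diverges at numbers that are not ranks. By injectivity of the
  rank the search has at most one solution.\<close>

definition rank_inverse :: "nat \<Rightarrow> nat option" where
  "rank_inverse n = (if \<exists>y. y \<in> L \<and> \<rho> y = n then Some (LEAST y. y \<in> L \<and> \<rho> y = n) else None)"

lemma rank_inverse_eq_Some: "rank_inverse n = Some y \<longleftrightarrow> y \<in> L \<and> \<rho> y = n"
proof -
  have "(LEAST y. y \<in> L \<and> \<rho> y = n) = y" if "y \<in> L" "\<rho> y = n" for y
    using that inj_rank by (intro Least_equality) (auto simp: inj_on_def)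
  then show ?thesis by (auto simp: rank_inverse_def)
qed

lemma partial_computable_rank_inverse: "partial_computable rank_inverse"
  unfolding rank_inverse_def
  by (rule partial_computable_search)
    (intro comp_fun computable_fun_comp[OF computable_rank] computable_fun_comp[OF computable_carrier])

end

section \<open>Cohesive powers of ranked orders\<close>

locale ranked_cohesive = ranked_order +
  fixes C :: "nat set"
  assumes cohesive: "cohesive C"
begin

text \<open>Almost inclusion of \<open>C\<close>, seen as a filter, so that finitely many "almost
  everywhere on \<open>C\<close>" facts combine pointwise.\<close>

definition F :: "nat filter" where "F = inf cofinite (principal C)"

lemma eventually_F: "eventually P F \<longleftrightarrow> C \<subseteq>* {x. P x}"
proof -
  have "{x. \<not> (x \<in> C \<longrightarrow> P x)} = C - {x. P x}" by auto
  then show ?thesis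
    by (simp add: F_def eventually_inf_principal eventually_cofinite almost_subset_def)
qed

lemma F_nontrivial: "\<not> eventually (\<lambda>_. False) F"
  using cohesive by (simp add: eventually_F almost_subset_def cohesive_def)

lemma eventually_F_gt: "eventually (\<lambda>x. k < x) F"
proof -
  have "C - {x. k < x} \<subseteq> {..k}" by auto
  then show ?thesis by (simp add: eventually_F almost_subset_def finite_subset)
qed

text \<open>Cohesiveness as a zero-one law for c.e. properties; neither alternative is claimed to be
  found effectively.\<close>

lemma eventually_ce:
  assumes "partial_computable \<phi>" "\<And>x. P x \<longleftrightarrow> \<phi> x \<noteq> None"
  shows "eventually P F \<or> eventually (\<lambda>x. \<not> P x) F"
proof -
  have "ce_set (Collect P)"
    unfolding ce_set_def using assms by (intro exI[of _ \<phi>]) (auto simp: dom_def)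
  then have "finite (C - Collect P) \<or> finite (C \<inter> Collect P)"
    using cohesive unfolding cohesive_def by blast
  moreover have "C \<inter> Collect P = C - {x. \<not> P x}" by auto
  ultimately show ?thesis by (simp add: eventually_F almost_subset_def)
qed

abbreviation X :: "(nat \<Rightarrow> nat option) set" where "X \<equiv> cohesive_funs C L"

text \<open>Where \<open>\<phi>\<close> is undefined the value is arbitrary; for
  \<open>\<phi>\<close> in \<open>X\<close> the filter \<open>F\<close> ignores such
  arguments.\<close>

definition rank_fun :: "(nat \<Rightarrow> nat option) \<Rightarrow> nat \<Rightarrow> nat" where
  "rank_fun \<phi> x = \<rho> (the (\<phi> x))"

lemma X_eventually: "\<phi> \<in> X \<Longrightarrow> eventually (\<lambda>x. \<exists>a\<in>L. \<phi> x = Some a) F"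
  unfolding eventually_F cohesive_funs_def
  by (rule almost_subset_Int2[of C "dom \<phi>" "dom \<phi>"]) (auto simp: ran_def)

text \<open>Unlike the totalised \<open>rank_fun\<close>, this keeps the undefinedness of its inputs
  and therefore stays partial computable.\<close>

definition rank_pair :: "(nat \<Rightarrow> nat option) \<Rightarrow> (nat \<Rightarrow> nat option) \<Rightarrow> nat \<Rightarrow> nat option" where
  "rank_pair \<phi> \<psi> x = map_option (\<lambda>z. prod_encode (\<rho> (pfst z), \<rho> (psnd z)))
     (Option.bind (\<phi> x) (\<lambda>a. map_option (\<lambda>b. prod_encode (a, b)) (\<psi> x)))"

lemma partial_computable_rank_pair:
  assumes "\<phi> \<in> X" "\<psi> \<in> X"
  shows "partial_computable (rank_pair \<phi> \<psi>)"
  unfolding rank_pair_def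
  using assms
  by (intro partial_computable_map partial_computable_pair comp_fun computable_fun_comp[OF computable_rank])
    (auto simp: cohesive_funs_def)

lemma eventually_rank_pair:
  assumes "\<phi> \<in> X" "\<psi> \<in> X"
  shows "eventually (\<lambda>x. rank_pair \<phi> \<psi> x = Some (prod_encode (rank_fun \<phi> x, rank_fun \<psi> x))) F"
  using X_eventually[OF assms(1)] X_eventually[OF assms(2)]
  by eventually_elim (auto simp: rank_pair_def rank_fun_def)

text \<open>An existential statement with decidable matrix \<open>Q\<close> is a c.e. property of
  the two ranks. Such a statement can express that a number is a rank, although the set of ranks may
  be undecidable.\<close>

lemma eventually_decide:
  assumes X: "\<phi> \<in> X" "\<psi> \<in> X"
    and Q: "computable_fun (\<lambda>z. of_bool (Q (pfst (pfst z)) (psnd (pfst z)) (psnd z)))"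
  shows "eventually (\<lambda>x. \<exists>z. Q (rank_fun \<phi> x) (rank_fun \<psi> x) z) F \<or>
    eventually (\<lambda>x. \<not> (\<exists>z. Q (rank_fun \<phi> x) (rank_fun \<psi> x) z)) F"
proof -
  \<comment> \<open>Convergence of both functions is built into the property, so that it is the
    domain of a partial computable function.\<close>
  let ?P = "\<lambda>x. \<exists>m. rank_pair \<phi> \<psi> x = Some m \<and> (\<exists>z. Q (pfst m) (psnd m) z)"
  have "eventually ?P F \<or> eventually (\<lambda>x. \<not> ?P x) F"
    by (rule eventually_ce, rule partial_computable_bind[OF partial_computable_rank_pair[OF X]
        partial_computable_search[OF Q]]) (auto simp: bind_eq_None_conv)
  then show ?thesis
  proof
    assume "eventually ?P F"
    with eventually_rank_pair[OF X]
    have "eventually (\<lambda>x. \<exists>z. Q (rank_fun \<phi> x) (rank_fun \<psi> x) z) F" by eventually_elim auto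
    then show ?thesis ..
  next
    assume "eventually (\<lambda>x. \<not> ?P x) F"
    with eventually_rank_pair[OF X]
    have "eventually (\<lambda>x. \<not> (\<exists>z. Q (rank_fun \<phi> x) (rank_fun \<psi> x) z)) F" by eventually_elim auto
    then show ?thesis ..
  qed
qed

text \<open>Composing \<open>g\<close> with \<open>rank_inverse\<close> gives the required member of
  \<open>X\<close>. Values of \<open>g\<close> that are not ranks merely cause divergence, and this
  happens only finitely often on \<open>C\<close>.\<close>

lemma realize:
  assumes g: "partial_computable g" and ev: "eventually (\<lambda>x. \<exists>n\<in>\<rho> ` L. g x = Some n) F"
  shows "\<exists>\<phi>\<in>X. eventually (\<lambda>x. g x = Some (rank_fun \<phi> x)) F"
proof -
  define \<phi> where "\<phi> = (\<lambda>x. Option.bind (g x) rank_inverse)"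
  have \<phi>: "\<phi> x = Some y \<longleftrightarrow> y \<in> L \<and> g x = Some (\<rho> y)" for x y
    by (auto simp: \<phi>_def bind_eq_Some_conv rank_inverse_eq_Some)
  have *: "eventually (\<lambda>x. \<exists>y. \<phi> x = Some y \<and> g x = Some (\<rho> y)) F"
    using ev by eventually_elim (auto simp: \<phi>)
  then have "C \<subseteq>* {x. \<exists>y. \<phi> x = Some y \<and> g x = Some (\<rho> y)}" by (simp add: eventually_F)
  then have "C \<subseteq>* dom \<phi>"
    by (rule almost_subset_Int2) (rule \<open>C \<subseteq>* _\<close>, auto)
  moreover have "partial_computable \<phi>"
    unfolding \<phi>_def by (rule partial_computable_bind[OF g partial_computable_rank_inverse])
  moreover have "ran \<phi> \<subseteq> L" by (auto simp: ran_def \<phi>)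
  ultimately have "\<phi> \<in> X" by (simp add: cohesive_funs_def)
  moreover have "eventually (\<lambda>x. g x = Some (rank_fun \<phi> x)) F"
    using * by eventually_elim (auto simp: rank_fun_def)
  ultimately show ?thesis by blast
qed

lemma realize_rank:
  assumes X: "\<phi> \<in> X" "\<psi> \<in> X" and f: "computable_fun (\<lambda>z. f (pfst z) (psnd z))"
    and ev: "eventually (\<lambda>x. f (rank_fun \<phi> x) (rank_fun \<psi> x) \<in> \<rho> ` L) F"
  shows "\<exists>\<chi>\<in>X. eventually (\<lambda>x. rank_fun \<chi> x = f (rank_fun \<phi> x) (rank_fun \<psi> x)) F"
proof -
  let ?g = "\<lambda>x. map_option (\<lambda>z. f (pfst z) (psnd z)) (rank_pair \<phi> \<psi> x)"
  have "eventually (\<lambda>x. \<exists>n\<in>\<rho> ` L. ?g x = Some n) F"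
    using eventually_rank_pair[OF X] ev by eventually_elim auto
  from realize[OF partial_computable_map[OF partial_computable_rank_pair[OF X] f] this]
  obtain \<chi> where \<chi>: "\<chi> \<in> X" "eventually (\<lambda>x. ?g x = Some (rank_fun \<chi> x)) F" by blast
  from \<chi>(2) eventually_rank_pair[OF X]
  have "eventually (\<lambda>x. rank_fun \<chi> x = f (rank_fun \<phi> x) (rank_fun \<psi> x)) F"
    by eventually_elim auto
  then show ?thesis using \<chi>(1) by blast
qed

section \<open>Classes of the cohesive power and their rank functions\<close>

abbreviation power :: "(nat \<Rightarrow> nat option) set set" where "power \<equiv> cohesive_power C L"

text \<open>Another representative has the same ranks almost everywhere on \<open>C\<close>, so
  \<open>N P\<close> is determined by \<open>P\<close> up to \<open>F\<close>.\<close>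

definition N :: "(nat \<Rightarrow> nat option) set \<Rightarrow> nat \<Rightarrow> nat" where
  "N P = rank_fun (SOME \<phi>. \<phi> \<in> P)"

text \<open>The rank is injective on \<open>L\<close>, so equal ranks at arguments where both
  functions converge mean equal values.\<close>

lemma cohesive_eq_iff:
  assumes "\<phi> \<in> X" "\<psi> \<in> X"
  shows "(\<phi>, \<psi>) \<in> cohesive_eq C L \<longleftrightarrow> eventually (\<lambda>x. rank_fun \<phi> x = rank_fun \<psi> x) F"
proof -
  have "(\<phi>, \<psi>) \<in> cohesive_eq C L \<longleftrightarrow> eventually (\<lambda>x. \<exists>a. \<phi> x = Some a \<and> \<psi> x = Some a) F"
    using assms by (simp add: cohesive_eq_def eventually_F)
  also have "\<dots> \<longleftrightarrow> eventually (\<lambda>x. rank_fun \<phi> x = rank_fun \<psi> x) F"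
  proof (rule eventually_cong)
    show "eventually (\<lambda>x. (\<exists>a\<in>L. \<phi> x = Some a) \<and> (\<exists>a\<in>L. \<psi> x = Some a)) F"
      using assms X_eventually by (simp add: eventually_conj_iff)
  qed (use inj_rank in \<open>auto simp: rank_fun_def inj_on_def\<close>)
  finally show ?thesis .
qed

lemma cohesive_fun_less_iff:
  assumes "\<phi> \<in> X" "\<psi> \<in> X"
  shows "cohesive_fun_less C rank_less \<phi> \<psi> \<longleftrightarrow> eventually (\<lambda>x. rank_fun \<phi> x < rank_fun \<psi> x) F"
  unfolding cohesive_fun_less_def eventually_F[symmetric]
proof (rule eventually_cong)
  show "eventually (\<lambda>x. (\<exists>a\<in>L. \<phi> x = Some a) \<and> (\<exists>a\<in>L. \<psi> x = Some a)) F"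
    using assms X_eventually by (simp add: eventually_conj_iff)
qed (auto simp: rank_fun_def rank_less_def)

lemma power_rep:
  assumes "P \<in> power"
  obtains \<phi> where "\<phi> \<in> X" "P = cohesive_eq C L `` {\<phi>}" "N P = rank_fun \<phi>"
proof -
  obtain \<psi> where \<psi>: "\<psi> \<in> X" "P = cohesive_eq C L `` {\<psi>}"
    using assms by (auto simp: cohesive_power_def elim: quotientE)
  define \<phi> where "\<phi> = (SOME \<phi>. \<phi> \<in> P)"
  have "\<psi> \<in> P" using \<psi> equiv_class_self[OF equiv_cohesive_eq] by simp
  then have "\<phi> \<in> P" unfolding \<phi>_def by (rule someI[of "\<lambda>\<phi>. \<phi> \<in> P"])
  then have "(\<psi>, \<phi>) \<in> cohesive_eq C L" using \<psi>(2) by simp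
  then have "\<phi> \<in> X" "P = cohesive_eq C L `` {\<phi>}"
    using \<psi>(2) equiv_class_eq[OF equiv_cohesive_eq \<open>(\<psi>, \<phi>) \<in> _\<close>]
    by (simp_all add: cohesive_eq_def)
  moreover have "N P = rank_fun \<phi>" by (simp add: N_def \<phi>_def)
  ultimately show ?thesis by (rule that)
qed

lemma power_class:
  assumes "\<phi> \<in> X"
  shows "\<exists>P\<in>power. eventually (\<lambda>x. N P x = rank_fun \<phi> x) F"
proof -
  let ?P = "cohesive_eq C L `` {\<phi>}"
  have P: "?P \<in> power" using assms by (auto simp: cohesive_power_def intro: quotientI)
  then obtain \<psi> where \<psi>: "\<psi> \<in> X" "?P = cohesive_eq C L `` {\<psi>}" "N ?P = rank_fun \<psi>"
    by (rule power_rep)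
  then have "(\<psi>, \<phi>) \<in> cohesive_eq C L"
    using assms eq_equiv_class[OF \<psi>(2)[symmetric] equiv_cohesive_eq] by blast
  then show ?thesis using \<psi> P assms cohesive_eq_iff by (intro bexI[of _ ?P]) simp_all
qed

lemma power_less_iff:
  assumes "P \<in> power" "Q \<in> power"
  shows "(P, Q) \<in> cohesive_power_less C L rank_less \<longleftrightarrow> eventually (\<lambda>x. N P x < N Q x) F"
proof -
  obtain \<phi> where \<phi>: "\<phi> \<in> X" "P = cohesive_eq C L `` {\<phi>}" "N P = rank_fun \<phi>"
    using assms(1) by (rule power_rep)
  obtain \<psi> where \<psi>: "\<psi> \<in> X" "Q = cohesive_eq C L `` {\<psi>}" "N Q = rank_fun \<psi>"
    using assms(2) by (rule power_rep)
  have self: "\<phi> \<in> P" "\<psi> \<in> Q" using \<phi> \<psi> equiv_class_self[OF equiv_cohesive_eq] by auto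
  have "(P, Q) \<in> cohesive_power_less C L rank_less \<longleftrightarrow> cohesive_fun_less C rank_less \<phi> \<psi>"
  proof
    assume "(P, Q) \<in> cohesive_power_less C L rank_less"
    then obtain \<phi>' \<psi>' where "\<phi>' \<in> P" "\<psi>' \<in> Q" "cohesive_fun_less C rank_less \<phi>' \<psi>'"
      by (auto simp: cohesive_power_less_def)
    moreover from this have "(\<phi>', \<phi>) \<in> cohesive_eq C L" "(\<psi>', \<psi>) \<in> cohesive_eq C L"
      using \<phi>(2) \<psi>(2) equiv_cohesive_eq by (auto dest: equivE symD)
    ultimately show "cohesive_fun_less C rank_less \<phi> \<psi>" using cohesive_fun_less_cong by blast
  next
    assume "cohesive_fun_less C rank_less \<phi> \<psi>"
    then show "(P, Q) \<in> cohesive_power_less C L rank_less"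
      using self assms by (auto simp: cohesive_power_less_def)
  qed
  then show ?thesis using \<phi> \<psi> cohesive_fun_less_iff by simp
qed

lemma power_eq_iff:
  assumes "P \<in> power" "Q \<in> power"
  shows "P = Q \<longleftrightarrow> eventually (\<lambda>x. N P x = N Q x) F"
proof -
  obtain \<phi> where \<phi>: "\<phi> \<in> X" "P = cohesive_eq C L `` {\<phi>}" "N P = rank_fun \<phi>"
    using assms(1) by (rule power_rep)
  obtain \<psi> where \<psi>: "\<psi> \<in> X" "Q = cohesive_eq C L `` {\<psi>}" "N Q = rank_fun \<psi>"
    using assms(2) by (rule power_rep)
  show ?thesis
    using eq_equiv_class_iff[OF equiv_cohesive_eq \<phi>(1) \<psi>(1)] cohesive_eq_iff \<phi> \<psi> by simp
qed

lemma power_realize: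
  assumes "P \<in> power" "Q \<in> power" "computable_fun (\<lambda>z. f (pfst z) (psnd z))"
    and "eventually (\<lambda>x. f (N P x) (N Q x) \<in> \<rho> ` L) F"
  shows "\<exists>R\<in>power. eventually (\<lambda>x. N R x = f (N P x) (N Q x)) F"
proof -
  obtain \<phi> where \<phi>: "\<phi> \<in> X" "N P = rank_fun \<phi>" using assms(1) by (rule power_rep)
  obtain \<psi> where \<psi>: "\<psi> \<in> X" "N Q = rank_fun \<psi>" using assms(2) by (rule power_rep)
  obtain \<chi> where \<chi>: "\<chi> \<in> X" "eventually (\<lambda>x. rank_fun \<chi> x = f (N P x) (N Q x)) F"
    using realize_rank[OF \<phi>(1) \<psi>(1) assms(3)] assms(4) \<phi>(2) \<psi>(2) by auto
  obtain R where R: "R \<in> power" "eventually (\<lambda>x. N R x = rank_fun \<chi> x) F"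
    using power_class[OF \<chi>(1)] by blast
  from R(2) \<chi>(2) have "eventually (\<lambda>x. N R x = f (N P x) (N Q x)) F" by eventually_elim simp
  then show ?thesis using R(1) by blast
qed

lemma power_decide:
  assumes "P \<in> power" "Q \<in> power"
    and "computable_fun (\<lambda>z. of_bool (R (pfst (pfst z)) (psnd (pfst z)) (psnd z)))"
  shows "eventually (\<lambda>x. \<exists>z. R (N P x) (N Q x) z) F \<or> eventually (\<lambda>x. \<not> (\<exists>z. R (N P x) (N Q x) z)) F"
proof -
  obtain \<phi> where \<phi>: "\<phi> \<in> X" "N P = rank_fun \<phi>" using assms(1) by (rule power_rep)
  obtain \<psi> where \<psi>: "\<psi> \<in> X" "N Q = rank_fun \<psi>" using assms(2) by (rule power_rep)
  show ?thesis using eventually_decide[OF \<phi>(1) \<psi>(1) assms(3)] \<phi>(2) \<psi>(2) by simp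
qed

lemma power_rank_in:
  assumes "P \<in> power"
  shows "eventually (\<lambda>x. N P x \<in> \<rho> ` L) F"
proof -
  obtain \<phi> where \<phi>: "\<phi> \<in> X" "N P = rank_fun \<phi>" using assms by (rule power_rep)
  show ?thesis using X_eventually[OF \<phi>(1)] by eventually_elim (auto simp: \<phi>(2) rank_fun_def)
qed

lemma power_decide_less:
  assumes "P \<in> power" "Q \<in> power"
  shows "eventually (\<lambda>x. N P x < N Q x) F \<or> eventually (\<lambda>x. N Q x \<le> N P x) F"
proof -
  have "computable_fun (\<lambda>z. of_bool (pfst (pfst z) < psnd (pfst z)))" by (intro comp_fun)
  from power_decide[OF assms, of "\<lambda>m n z. m < n", OF this] show ?thesis by (simp add: not_less)
qed

lemma power_decide_rank:
  assumes "P \<in> power" "computable_fun f"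
  shows "eventually (\<lambda>x. f (N P x) \<in> \<rho> ` L) F \<or> eventually (\<lambda>x. f (N P x) \<notin> \<rho> ` L) F"
proof -
  have "computable_fun (\<lambda>z. of_bool (psnd z \<in> L \<and> \<rho> (psnd z) = f (pfst (pfst z))))"
    by (intro comp_fun computable_fun_comp[OF computable_rank] computable_fun_comp[OF computable_carrier]
        computable_fun_comp[OF assms(2)])
  moreover have "(\<exists>z. z \<in> L \<and> \<rho> z = m) \<longleftrightarrow> m \<in> \<rho> ` L" for m by auto
  ultimately show ?thesis
    using power_decide[OF assms(1) assms(1), of "\<lambda>m n z. z \<in> L \<and> \<rho> z = f m"] by simp
qed

section \<open>Neighbours in the power\<close>

lemma rank_even: "even n \<Longrightarrow> n \<in> \<rho> ` L"
  using even_rank by (auto elim: evenE)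

text \<open>If \<open>N P x + 1\<close> is not a rank it must be odd, since all even numbers are
  ranks; then \<open>N P x + 2\<close> is even and the next rank. The bound by 2 will relate finite
  distance in the power to rank differences.\<close>

lemma power_succ:
  assumes "P \<in> power"
  shows "\<exists>Q\<in>power. eventually (\<lambda>x. N P x < N Q x \<and> N Q x \<le> N P x + 2 \<and>
    (\<forall>n\<in>\<rho> ` L. N P x < n \<longrightarrow> N Q x \<le> n)) F"
proof -
  have "computable_fun (\<lambda>n. Suc n)" by (intro comp_fun)
  \<comment> \<open>One alternative holds for almost all of \<open>C\<close>, so a single computable
    map describes the successor in each case.\<close>
  from power_decide_rank[OF assms this] show ?thesis
  proof
    assume ev: "eventually (\<lambda>x. Suc (N P x) \<in> \<rho> ` L) F"
    have "computable_fun (\<lambda>z. Suc (pfst z))" by (intro comp_fun)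
    from power_realize[OF assms assms this ev] obtain Q
      where Q: "Q \<in> power" "eventually (\<lambda>x. N Q x = Suc (N P x)) F" by blast
    from Q(2) have "eventually (\<lambda>x. N P x < N Q x \<and> N Q x \<le> N P x + 2 \<and>
        (\<forall>n\<in>\<rho> ` L. N P x < n \<longrightarrow> N Q x \<le> n)) F"
      by eventually_elim auto
    then show ?thesis using Q(1) by blast
  next
    assume odd: "eventually (\<lambda>x. Suc (N P x) \<notin> \<rho> ` L) F"
    then have ev: "eventually (\<lambda>x. Suc (Suc (N P x)) \<in> \<rho> ` L) F"
    proof eventually_elim
      case (elim x)
      then have "odd (Suc (N P x))" using rank_even by blast
      then show ?case using rank_even by simp
    qed
    have "computable_fun (\<lambda>z. Suc (Suc (pfst z)))" by (intro comp_fun)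
    from power_realize[OF assms assms this ev] obtain Q
      where Q: "Q \<in> power" "eventually (\<lambda>x. N Q x = Suc (Suc (N P x))) F" by blast
    from Q(2) odd have "eventually (\<lambda>x. N P x < N Q x \<and> N Q x \<le> N P x + 2 \<and>
        (\<forall>n\<in>\<rho> ` L. N P x < n \<longrightarrow> N Q x \<le> n)) F"
    proof eventually_elim
      case (elim x)
      have "Suc (Suc (N P x)) \<le> n" if "n \<in> \<rho> ` L" "N P x < n" for n
        using that elim(2) by (metis Suc_leI le_neq_implies_less)
      then show ?case using elim(1) by auto
    qed
    then show ?thesis using Q(1) by blast
  qed
qed

lemma power_pred:
  assumes "P \<in> power" and pos: "eventually (\<lambda>x. 0 < N P x) F"
  shows "\<exists>Q\<in>power. eventually (\<lambda>x. N Q x < N P x \<and> (\<forall>n\<in>\<rho> ` L. N Q x < n \<longrightarrow> N P x \<le> n)) F"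
proof -
  have "computable_fun (\<lambda>n. n - 1)" by (intro comp_fun)
  from power_decide_rank[OF assms(1) this] show ?thesis
  proof
    assume ev: "eventually (\<lambda>x. N P x - 1 \<in> \<rho> ` L) F"
    have "computable_fun (\<lambda>z. pfst z - 1)" by (intro comp_fun)
    from power_realize[OF assms(1) assms(1) this ev] obtain Q
      where Q: "Q \<in> power" "eventually (\<lambda>x. N Q x = N P x - 1) F" by blast
    from Q(2) pos have "eventually (\<lambda>x. N Q x < N P x \<and> (\<forall>n\<in>\<rho> ` L. N Q x < n \<longrightarrow> N P x \<le> n)) F"
      by eventually_elim auto
    then show ?thesis using Q(1) by blast
  next
    assume odd: "eventually (\<lambda>x. N P x - 1 \<notin> \<rho> ` L) F"
    then have ev: "eventually (\<lambda>x. N P x - 2 \<in> \<rho> ` L) F"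
    proof eventually_elim
      case (elim x)
      then have "odd (N P x - 1)" using rank_even by blast
      then show ?case using rank_even by simp
    qed
    have "computable_fun (\<lambda>z. pfst z - 2)" by (intro comp_fun)
    from power_realize[OF assms(1) assms(1) this ev] obtain Q
      where Q: "Q \<in> power" "eventually (\<lambda>x. N Q x = N P x - 2) F" by blast
    from Q(2) odd have "eventually (\<lambda>x. N Q x < N P x \<and> (\<forall>n\<in>\<rho> ` L. N Q x < n \<longrightarrow> N P x \<le> n)) F"
    proof eventually_elim
      case (elim x)
      \<comment> \<open>An odd number is not 0, so the rank is at least 2 and the subtraction of 2
        is not truncated.\<close>
      have "odd (N P x - 1)" using elim(2) rank_even by blast
      then have "2 \<le> N P x" by (cases "N P x") (auto elim: oddE)
      moreover have "N P x \<le> n" if "n \<in> \<rho> ` L" "N P x - 2 < n" for n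
      proof -
        have "n \<noteq> N P x - 1" using that(1) elim(2) by blast
        then show ?thesis using that(2) by simp
      qed
      ultimately show ?case using elim(1) by auto
    qed
    then show ?thesis using Q(1) by blast
  qed
qed

definition succ_class :: "(nat \<Rightarrow> nat option) set \<Rightarrow> (nat \<Rightarrow> nat option) set" where
  "succ_class P = (SOME Q. Q \<in> power \<and> eventually (\<lambda>x. N P x < N Q x \<and> N Q x \<le> N P x + 2 \<and>
    (\<forall>n\<in>\<rho> ` L. N P x < n \<longrightarrow> N Q x \<le> n)) F)"

lemma succ_class:
  assumes "P \<in> power"
  shows "succ_class P \<in> power"
    and "eventually (\<lambda>x. N P x < N (succ_class P) x \<and> N (succ_class P) x \<le> N P x + 2 \<and>
      (\<forall>n\<in>\<rho> ` L. N P x < n \<longrightarrow> N (succ_class P) x \<le> n)) F"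
  using someI_ex[OF power_succ[OF assms, unfolded Bex_def]] unfolding succ_class_def by blast+

text \<open>Doubling guarantees that the values are ranks. The class of \<open>2 * x\<close> exceeds
  every constant almost everywhere on \<open>C\<close> and will make the power unbounded in the
  sense of \<open>far\<close>.\<close>

lemma ex_zero_class: "\<exists>P\<in>power. eventually (\<lambda>x. N P x = 0) F"
  and ex_id_class: "\<exists>P\<in>power. eventually (\<lambda>x. N P x = 2 * x) F"
proof -
  have *: "\<exists>P\<in>power. eventually (\<lambda>x. N P x = 2 * f x) F" if f: "computable_fun f" for f
  proof -
    have "partial_computable (\<lambda>x. Some (2 * f x))"
      by (rule partial_computable_total) (intro comp_fun f)
    moreover have "eventually (\<lambda>x. \<exists>n\<in>\<rho> ` L. Some (2 * f x) = Some n) F"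
      using even_rank by (intro always_eventually) auto
    ultimately obtain \<phi> where \<phi>: "\<phi> \<in> X" "eventually (\<lambda>x. Some (2 * f x) = Some (rank_fun \<phi> x)) F"
      using realize by blast
    obtain P where P: "P \<in> power" "eventually (\<lambda>x. N P x = rank_fun \<phi> x) F"
      using power_class[OF \<phi>(1)] by blast
    from \<phi>(2) P(2) have "eventually (\<lambda>x. N P x = 2 * f x) F" by eventually_elim simp
    then show ?thesis using P(1) by blast
  qed
  show "\<exists>P\<in>power. eventually (\<lambda>x. N P x = 0) F" using *[of "\<lambda>_. 0"] by (simp add: comp_fun)
  show "\<exists>P\<in>power. eventually (\<lambda>x. N P x = 2 * x) F" using *[of "\<lambda>x. x"] by (simp add: comp_fun)
qed

definition zero_class :: "(nat \<Rightarrow> nat option) set" where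
  "zero_class = (SOME P. P \<in> power \<and> eventually (\<lambda>x. N P x = 0) F)"

lemma zero_class: "zero_class \<in> power" "eventually (\<lambda>x. N zero_class x = 0) F"
  using someI_ex[OF ex_zero_class[unfolded Bex_def]] unfolding zero_class_def by blast+

section \<open>The power as a discrete order\<close>

abbreviation power_less where "power_less \<equiv> cohesive_power_less C L rank_less"

sublocale power: discrete_order power power_less succ_class zero_class
proof
  have sub: "power_less \<subseteq> power \<times> power" by (auto simp: cohesive_power_less_def)
  show "trans power_less"
  proof (rule transI)
    fix P Q R assume *: "(P, Q) \<in> power_less" "(Q, R) \<in> power_less"
    then have "P \<in> power" "Q \<in> power" "R \<in> power" using sub by auto
    with * have "eventually (\<lambda>x. N P x < N Q x) F" "eventually (\<lambda>x. N Q x < N R x) F"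
      by (simp_all add: power_less_iff)
    then have "eventually (\<lambda>x. N P x < N R x) F" by eventually_elim simp
    then show "(P, R) \<in> power_less" using \<open>P \<in> power\<close> \<open>R \<in> power\<close> by (simp add: power_less_iff)
  qed
  show "irrefl power_less"
  proof (rule irreflI, rule notI)
    fix P assume *: "(P, P) \<in> power_less"
    then have "eventually (\<lambda>x. N P x < N P x) F" using sub power_less_iff[of P P] by auto
    then show False using F_nontrivial by simp
  qed
  show "total_on power power_less"
  proof (rule total_onI)
    fix P Q assume PQ: "P \<in> power" "Q \<in> power" "P \<noteq> Q"
    show "(P, Q) \<in> power_less \<or> (Q, P) \<in> power_less"
    proof (rule ccontr)
      assume "\<not> ?thesis"
      then have "eventually (\<lambda>x. N Q x \<le> N P x) F" "eventually (\<lambda>x. N P x \<le> N Q x) F"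
        using power_decide_less[of P Q] power_decide_less[of Q P] power_less_iff PQ by auto
      then have "eventually (\<lambda>x. N P x = N Q x) F" by eventually_elim simp
      then show False using PQ power_eq_iff by blast
    qed
  qed
next
  fix P assume P: "P \<in> power"
  show "succ_class P \<in> power" using succ_class P by blast
  show "(P, succ_class P) \<in> power_less"
    using succ_class[OF P] P by (auto simp: power_less_iff elim: eventually_mono)
next
  fix P Q assume PQ: "P \<in> power" "Q \<in> power" "(P, Q) \<in> power_less"
  show "succ_class P = Q \<or> (succ_class P, Q) \<in> power_less"
  proof (rule ccontr)
    assume neg: "\<not> ?thesis"
    have "eventually (\<lambda>x. N P x < N Q x) F" using PQ power_less_iff by blast
    with succ_class(2)[OF PQ(1)] power_rank_in[OF PQ(2)]
    have 1: "eventually (\<lambda>x. N (succ_class P) x \<le> N Q x) F" by eventually_elim blast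
    moreover have "eventually (\<lambda>x. N Q x \<le> N (succ_class P) x) F"
      using neg power_decide_less[of "succ_class P" Q] power_less_iff succ_class PQ by blast
    ultimately have "eventually (\<lambda>x. N (succ_class P) x = N Q x) F" by eventually_elim simp
    then show False using neg power_eq_iff succ_class PQ by blast
  qed
next
  show "zero_class \<in> power" by (rule zero_class)
next
  fix P assume P: "P \<in> power"
  show "(P, zero_class) \<notin> power_less"
  proof
    assume "(P, zero_class) \<in> power_less"
    then have "eventually (\<lambda>x. N P x < N zero_class x) F" using power_less_iff P zero_class by blast
    with zero_class(2) have "eventually (\<lambda>x. False) F" by eventually_elim simp
    then show False using F_nontrivial by blast
  qed
next
  fix P assume P: "P \<in> power" "P \<noteq> zero_class"
  have "\<not> eventually (\<lambda>x. N P x \<le> N zero_class x) F"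
  proof
    assume "eventually (\<lambda>x. N P x \<le> N zero_class x) F"
    with zero_class(2) have "eventually (\<lambda>x. N P x = N zero_class x) F" by eventually_elim simp
    then show False using P power_eq_iff zero_class by blast
  qed
  then have "eventually (\<lambda>x. N zero_class x < N P x) F"
    using power_decide_less[of zero_class P] P zero_class by blast
  then have "eventually (\<lambda>x. 0 < N P x) F" by eventually_elim simp
  from power_pred[OF P(1) this] obtain Q where Q: "Q \<in> power"
    "eventually (\<lambda>x. N Q x < N P x \<and> (\<forall>n\<in>\<rho> ` L. N Q x < n \<longrightarrow> N P x \<le> n)) F" by blast
  \<comment> \<open>Both \<open>P\<close> and the successor of \<open>Q\<close> have, almost
    everywhere, the least rank above that of \<open>Q\<close>.\<close>
  from Q(2) succ_class(2)[OF Q(1)] power_rank_in[OF P(1)] power_rank_in[OF succ_class(1)[OF Q(1)]]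
  have "eventually (\<lambda>x. N (succ_class Q) x = N P x) F"
    by eventually_elim (meson order_antisym)
  then show "\<exists>Q\<in>power. succ_class Q = P"
    using Q(1) power_eq_iff succ_class(1) P(1) by blast
qed

text \<open>Each successor raises the rank by 1 or 2.\<close>

lemma N_pow_succ:
  assumes "P \<in> power"
  shows "eventually (\<lambda>x. N P x + n \<le> N ((succ_class ^^ n) P) x \<and>
    N ((succ_class ^^ n) P) x \<le> N P x + 2 * n) F"
proof (induction n)
  case (Suc n)
  from Suc succ_class(2)[OF power.pow_in[OF assms, of n]] show ?case
    by eventually_elim auto
qed simp

text \<open>Since \<open>n\<close> successors raise the rank by at least \<open>n\<close> and at
  most \<open>2 * n\<close>, lying above all iterates is the same as exceeding the rank by more than
  any constant. Density and unboundedness thereby become statements about ranks.\<close>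

lemma far_iff:
  assumes "P \<in> power" "Q \<in> power"
  shows "power.far P Q \<longleftrightarrow> (\<forall>k. eventually (\<lambda>x. N P x + k < N Q x) F)"
proof
  assume far: "power.far P Q"
  show "\<forall>k. eventually (\<lambda>x. N P x + k < N Q x) F"
  proof
    fix k
    have "eventually (\<lambda>x. N ((succ_class ^^ k) P) x < N Q x) F"
      using far power_less_iff power.pow_in assms unfolding power.far_def by blast
    with N_pow_succ[OF assms(1), of k] show "eventually (\<lambda>x. N P x + k < N Q x) F"
      by eventually_elim simp
  qed
next
  assume *: "\<forall>k. eventually (\<lambda>x. N P x + k < N Q x) F"
  show "power.far P Q"
    unfolding power.far_def
  proof
    fix n
    have "eventually (\<lambda>x. N P x + 2 * n < N Q x) F" using * by blast
    with N_pow_succ[OF assms(1), of n]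
    have "eventually (\<lambda>x. N ((succ_class ^^ n) P) x < N Q x) F"
      by eventually_elim simp
    then show "((succ_class ^^ n) P, Q) \<in> power_less"
      using power_less_iff power.pow_in assms by blast
  qed
qed

lemma countable_power: "countable power"
proof -
  have "power \<subseteq> (\<lambda>\<phi>. cohesive_eq C L `` {\<phi>}) ` Collect partial_computable"
    by (auto simp: cohesive_power_def cohesive_funs_def elim!: quotientE)
  then show ?thesis
    by (rule countable_subset) (intro countable_image countable_partial_computable)
qed

theorem same_order_type_power: "same_order_type power power_less UNIV omega_plus_zeta_eta"
proof (rule power.same_order_type_omega_plus_zeta_eta[OF countable_power])
  fix P Q assume PQ: "P \<in> power" "Q \<in> power" "power.far P Q"
  \<comment> \<open>The midpoint of the two ranks, rounded down to an even number so that it is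
    certainly a rank.\<close>
  have "computable_fun (\<lambda>z. 2 * ((pfst z + psnd z) div 2 div 2))" by (intro comp_fun)
  from power_realize[OF PQ(1,2) this] obtain R where R: "R \<in> power"
    "eventually (\<lambda>x. N R x = 2 * ((N P x + N Q x) div 2 div 2)) F"
    using even_rank by (auto intro: always_eventually)
  have "eventually (\<lambda>x. N P x + k < N R x) F" "eventually (\<lambda>x. N R x + k < N Q x) F" for k
  proof -
    \<comment> \<open>Halving the gap costs the factor 2, and the summand 8 more than covers the
      rounding.\<close>
    have far: "eventually (\<lambda>x. N P x + (2 * k + 8) < N Q x) F" using PQ far_iff by blast
    show "eventually (\<lambda>x. N P x + k < N R x) F" using R(2) far by eventually_elim linarith
    show "eventually (\<lambda>x. N R x + k < N Q x) F" using R(2) far by eventually_elim linarith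
  qed
  then show "\<exists>R\<in>power. power.far P R \<and> power.far R Q" using R(1) far_iff PQ by blast
next
  fix P assume P: "P \<in> power"
  obtain I where I: "I \<in> power" "eventually (\<lambda>x. N I x = 2 * x) F" using ex_id_class by blast
  have "computable_fun (\<lambda>z. 2 * (pfst z + psnd z))" by (intro comp_fun)
  from power_realize[OF P I(1) this] obtain R where R: "R \<in> power"
    "eventually (\<lambda>x. N R x = 2 * (N P x + N I x)) F"
    using always_eventually[of "\<lambda>x. 2 * (N P x + N I x) \<in> \<rho> ` L"] even_rank by blast
  \<comment> \<open>The rank of \<open>R\<close> is \<open>2 * N P x + 4 * x\<close>, which passes
    \<open>N P x + k\<close> as soon as \<open>x\<close> exceeds \<open>k\<close>.\<close>
  have "eventually (\<lambda>x. N P x + k < N R x) F" for k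
    using R(2) I(2) eventually_F_gt[of k] by eventually_elim simp
  then show "\<exists>Q\<in>power. power.far P Q" using R(1) far_iff P by blast
qed

end

text \<open>The pair of \<open>a\<close> and 0 is the element of rank \<open>2 * a\<close>; the pair
  of \<open>a\<close> and its least certificate is the additional element. Storing the certificate
  keeps the carrier decidable although the set of those \<open>a\<close> is not.\<close>

definition certificate_order :: "nat set" where
  "certificate_order = {z. psnd z = 0 \<or> first_certificate (pfst z) (psnd z)}"

definition certificate_rank :: "nat \<Rightarrow> nat" where
  "certificate_rank z = 2 * pfst z + of_bool (0 < psnd z)"

lemma even_certificate_rank: "certificate_rank (prod_encode (n, 0)) = 2 * n"
  by (simp add: certificate_rank_def)

interpretation certificate: ranked_order certificate_order certificate_rank
proof
  show "computable_fun (\<lambda>x. of_bool (x \<in> certificate_order))"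
    unfolding certificate_order_def mem_Collect_eq by (intro comp_fun computable_first_certificate)
  show "computable_fun certificate_rank"
    unfolding certificate_rank_def by (intro comp_fun)
  show "inj_on certificate_rank certificate_order"
  proof (rule inj_onI)
    fix x y assume *: "x \<in> certificate_order" "y \<in> certificate_order"
      "certificate_rank x = certificate_rank y"
    have "pfst x = pfst y \<and> (0 < psnd x \<longleftrightarrow> 0 < psnd y)"
      using *(3) by (auto simp: certificate_rank_def of_bool_def split: if_splits) presburger+
    then have "pfst x = pfst y \<and> psnd x = psnd y"
      using *(1,2) first_certificate_unique by (auto simp: certificate_order_def)
    then show "x = y" by (metis prod_encode_pfst_psnd)
  qed
  show "2 * n \<in> certificate_rank ` certificate_order" for n
    using even_certificate_rank by (intro image_eqI[of _ _ "prod_encode (n, 0)"]) (auto simp: certificate_order_def)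
qed

lemma odd_certificate_rank_iff:
  "2 * e + 1 \<in> certificate_rank ` certificate_order \<longleftrightarrow> (\<exists>n. halting_certificate e n)"
  unfolding ex_first_certificate[symmetric]
proof
  assume "2 * e + 1 \<in> certificate_rank ` certificate_order"
  then obtain z where z: "z \<in> certificate_order" "certificate_rank z = 2 * e + 1" by fastforce
  then have "0 < psnd z" "pfst z = e"
    by (auto simp: certificate_rank_def of_bool_def split: if_splits) presburger
  then show "\<exists>n. first_certificate e n" using z(1) by (auto simp: certificate_order_def)
next
  assume "\<exists>n. first_certificate e n"
  then obtain n where n: "first_certificate e n" by blast
  then have "0 < n" using not_first_certificate_0 by (cases n) auto
  with n show "2 * e + 1 \<in> certificate_rank ` certificate_order"
    by (intro image_eqI[of _ _ "prod_encode (e, n)"])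
      (auto simp: certificate_order_def certificate_rank_def)
qed

theorem theorem4p8:
  shows "\<exists>L r. computable_linear_order L r
           \<and> same_order_type L r (UNIV :: nat set) less_rel
           \<and> \<not> computably_isomorphic L r (UNIV :: nat set) less_rel
           \<and> (\<forall>C. cohesive C \<longrightarrow>
                same_order_type (cohesive_power C L) (cohesive_power_less C L r)
                  UNIV omega_plus_zeta_eta)"
proof (intro exI conjI allI impI)
  let ?L = certificate_order and ?r = certificate.rank_less
  show "computable_linear_order ?L ?r" by (rule certificate.computable_linear_order_rank)
  show "same_order_type ?L ?r (UNIV :: nat set) less_rel" by (rule certificate.same_order_type_rank)
  show "\<not> computably_isomorphic ?L ?r (UNIV :: nat set) less_rel"
  proof
    assume "computably_isomorphic ?L ?r (UNIV :: nat set) less_rel"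
    moreover have "computable_fun (\<lambda>n. prod_encode (n, 0))" by (intro comp_fun)
    moreover have "prod_encode (n, 0) \<in> ?L" for n by (simp add: certificate_order_def)
    ultimately have "computable_fun (\<lambda>e. of_bool (2 * e + 1 \<in> certificate_rank ` certificate_order))"
      by (rule certificate.computable_odd_rank_if_computably_isomorphic) (rule even_certificate_rank)
    then show False using not_computable_halting by (simp only: odd_certificate_rank_iff)
  qed
  show "same_order_type (cohesive_power C ?L) (cohesive_power_less C ?L ?r) UNIV omega_plus_zeta_eta"
    if "cohesive C" for C
  proof -
    interpret ranked_cohesive certificate_order certificate_rank C
      by unfold_locales (rule that)
    show ?thesis by (rule same_order_type_power)
  qed
qed

end
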